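(* Let $k$ be a field. The coordinate algebra functor $k[-]$ is a duality (contravariant equivalence of categories) between the category of affine algebraic subvarieties of $k$ (with regular morphisms) and the category of essential $k$-algebras of finite type (with $k$-algebra morphisms).
   Context: $k$ is an arbitrary field; rings are commutative and unital. An algebraic subset of $k^n$ is a set $V=\{P\in k^n:\forall f\in I,\ f(P)=0\}$ for an ideal $I$ of $k[X_1,\ldots,X_n]$. Its coordinate algebra is $k[V]=k[X_1,\ldots,X_n]/\mathcal I(V)$, where $\mathcal I(V)=\{f : \forall P\in V,\ f(P)=0\}$; elements of $k[V]$ are viewed as functions $V\to k$. The affine algebraic subvarieties of $k$ are the algebraic subsets $V\subseteq k^n$, $n\in\mathbb N$ (each one canonically equipped with its sheaf of regular functions). A regular morphism from $V\subseteq k^n$ to $W\subseteq k^m$ is a map $f:V\to W$ such that there exist $f_1,\ldots,f_m\in k[V]$ with $f(P)=(f_1(P),\ldots,f_m(P))$ for all $P\in V$. The functor $k[-]$ sends $V$ to $k[V]$ and $f:V\to W$ to $k[f]:k[W]\to k[V]$, $g\mapsto g\circ f$. A $k$-algebra is essential if it embeds as a $k$-algebra into a power $k^S$ of $k$ (for some set $S$, possibly empty). *)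

theory Defs
  imports
    "HOL-Algebra.QuotRing"
    "HOL-Algebra.Algebraic_Closure_Type"
    "HOL-Library.Poly_Mapping"
begin

section \<open>Categories, functors, equivalences\<close>

text \<open>
  Hom-sets are indexed by pairs of objects and are not required to be pairwise disjoint;
  accordingly identities, composition and the action of a functor on morphisms take the
  objects involved as arguments.  \<open>Comp C U Y Z g f\<close> is the composite of \<open>f : U \<rightarrow> Y\<close>
  and \<open>g : Y \<rightarrow> Z\<close>.
\<close>

record ('o, 'm) cat =
  Obj :: "'o set"
  Hom :: "'o \<Rightarrow> 'o \<Rightarrow> 'm set"
  Id :: "'o \<Rightarrow> 'm"
  Comp :: "'o \<Rightarrow> 'o \<Rightarrow> 'o \<Rightarrow> 'm \<Rightarrow> 'm \<Rightarrow> 'm"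

locale category =
  fixes C :: "('o, 'm) cat"
  assumes Id_closed: "U \<in> Obj C \<Longrightarrow> Id C U \<in> Hom C U U"
    and Comp_closed: "\<lbrakk>U \<in> Obj C; Y \<in> Obj C; Z \<in> Obj C; f \<in> Hom C U Y; g \<in> Hom C Y Z\<rbrakk>
      \<Longrightarrow> Comp C U Y Z g f \<in> Hom C U Z"
    and Comp_Id_right: "\<lbrakk>U \<in> Obj C; Y \<in> Obj C; f \<in> Hom C U Y\<rbrakk> \<Longrightarrow> Comp C U U Y f (Id C U) = f"
    and Comp_Id_left: "\<lbrakk>U \<in> Obj C; Y \<in> Obj C; f \<in> Hom C U Y\<rbrakk> \<Longrightarrow> Comp C U Y Y (Id C Y) f = f"
    and Comp_assoc: "\<lbrakk>W \<in> Obj C; U \<in> Obj C; Y \<in> Obj C; Z \<in> Obj C;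
        f \<in> Hom C W U; g \<in> Hom C U Y; h \<in> Hom C Y Z\<rbrakk>
      \<Longrightarrow> Comp C W U Z (Comp C U Y Z h g) f = Comp C W Y Z h (Comp C W U Y g f)"

definition op_cat :: "('o, 'm) cat \<Rightarrow> ('o, 'm) cat" where
  "op_cat C = \<lparr> Obj = Obj C, Hom = (\<lambda>U Y. Hom C Y U), Id = Id C,
                Comp = (\<lambda>U Y Z g f. Comp C Z Y U f g) \<rparr>"

definition iso_arrow :: "('o, 'm) cat \<Rightarrow> 'o \<Rightarrow> 'o \<Rightarrow> 'm \<Rightarrow> bool" where
  "iso_arrow C U Y f \<longleftrightarrow> f \<in> Hom C U Y \<and>
     (\<exists>g \<in> Hom C Y U. Comp C U Y U g f = Id C U \<and> Comp C Y U Y f g = Id C Y)"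

locale cat_functor = dom: category C + cod: category D
  for C :: "('o, 'm) cat" and D :: "('p, 'n) cat" +
  fixes Fo :: "'o \<Rightarrow> 'p" and Fm :: "'o \<Rightarrow> 'o \<Rightarrow> 'm \<Rightarrow> 'n"
  assumes Fo_closed: "U \<in> Obj C \<Longrightarrow> Fo U \<in> Obj D"
    and Fm_closed: "\<lbrakk>U \<in> Obj C; Y \<in> Obj C; f \<in> Hom C U Y\<rbrakk> \<Longrightarrow> Fm U Y f \<in> Hom D (Fo U) (Fo Y)"
    and Fm_Id: "U \<in> Obj C \<Longrightarrow> Fm U U (Id C U) = Id D (Fo U)"
    and Fm_Comp: "\<lbrakk>U \<in> Obj C; Y \<in> Obj C; Z \<in> Obj C; f \<in> Hom C U Y; g \<in> Hom C Y Z\<rbrakk>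
      \<Longrightarrow> Fm U Z (Comp C U Y Z g f) = Comp D (Fo U) (Fo Y) (Fo Z) (Fm Y Z g) (Fm U Y f)"

definition naturally_isomorphic ::
  "('o, 'm) cat \<Rightarrow> ('p, 'n) cat \<Rightarrow> ('o \<Rightarrow> 'p) \<Rightarrow> ('o \<Rightarrow> 'o \<Rightarrow> 'm \<Rightarrow> 'n)
    \<Rightarrow> ('o \<Rightarrow> 'p) \<Rightarrow> ('o \<Rightarrow> 'o \<Rightarrow> 'm \<Rightarrow> 'n) \<Rightarrow> bool" where
  "naturally_isomorphic C D Fo Fm Go Gm \<longleftrightarrow>
     (\<exists>\<eta>. (\<forall>U \<in> Obj C. iso_arrow D (Fo U) (Go U) (\<eta> U)) \<and>
          (\<forall>U \<in> Obj C. \<forall>Y \<in> Obj C. \<forall>f \<in> Hom C U Y.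
             Comp D (Fo U) (Fo Y) (Go Y) (\<eta> Y) (Fm U Y f)
             = Comp D (Fo U) (Go U) (Go Y) (Gm U Y f) (\<eta> U)))"

definition cat_equivalence ::
  "('o, 'm) cat \<Rightarrow> ('p, 'n) cat \<Rightarrow> ('o \<Rightarrow> 'p) \<Rightarrow> ('o \<Rightarrow> 'o \<Rightarrow> 'm \<Rightarrow> 'n) \<Rightarrow> bool" where
  "cat_equivalence C D Fo Fm \<longleftrightarrow>
     cat_functor C D Fo Fm \<and>
     (\<exists>Go Gm. cat_functor D C Go Gm \<and>
        naturally_isomorphic C C (\<lambda>U. Go (Fo U)) (\<lambda>U Y f. Gm (Fo U) (Fo Y) (Fm U Y f))
          (\<lambda>U. U) (\<lambda>U Y f. f) \<and>
        naturally_isomorphic D D (\<lambda>A. Fo (Go A)) (\<lambda>A B h. Fm (Go A) (Go B) (Gm A B h))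
          (\<lambda>A. A) (\<lambda>A B h. h))"

text \<open>
  Here \<open>Fm U Y\<close> maps \<open>Hom C U Y\<close> to \<open>Hom D (Fo Y) (Fo U)\<close>.
\<close>

definition duality ::
  "('o, 'm) cat \<Rightarrow> ('p, 'n) cat \<Rightarrow> ('o \<Rightarrow> 'p) \<Rightarrow> ('o \<Rightarrow> 'o \<Rightarrow> 'm \<Rightarrow> 'n) \<Rightarrow> bool" where
  "duality C D Fo Fm \<longleftrightarrow> cat_equivalence (op_cat C) D Fo (\<lambda>U Y. Fm Y U)"


section \<open>Algebras over a field\<close>

definition k_algebra :: "('k::field, 'u) module \<Rightarrow> bool" where
  "k_algebra A \<longleftrightarrow> algebra (ring_of_type_algebra :: 'k ring) A"

definition alg_hom :: "('k::field, 'u) module \<Rightarrow> ('k, 'v) module \<Rightarrow> ('u \<Rightarrow> 'v) set" where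
  "alg_hom A B = {h \<in> carrier A \<rightarrow>\<^sub>E carrier B. h \<in> ring_hom A B \<and>
     (\<forall>c. \<forall>x \<in> carrier A. h (c \<odot>\<^bsub>A\<^esub> x) = c \<odot>\<^bsub>B\<^esub> h x)}"

definition power_algebra :: "'s set \<Rightarrow> ('k::field, 's \<Rightarrow> 'k) module" where
  "power_algebra S = \<lparr> carrier = S \<rightarrow>\<^sub>E UNIV,
     monoid.mult = (\<lambda>f g. \<lambda>s\<in>S. f s * g s), one = (\<lambda>s\<in>S. 1),
     ring.zero = (\<lambda>s\<in>S. 0), add = (\<lambda>f g. \<lambda>s\<in>S. f s + g s),
     module.smult = (\<lambda>c f. \<lambda>s\<in>S. c * f s) \<rparr>"

text \<open>
  HOL cannot quantify existentially over the type of the elements of the exponent set \<open>S\<close>.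
  The type \<open>'u \<Rightarrow> 'k\<close> used below is no restriction: by \<open>essentialI\<close>, an embedding
  into \<open>k\<^sup>S\<close> with \<open>S\<close> a set over any type whatsoever is sufficient.
\<close>

definition essential :: "('k::field, 'u) module \<Rightarrow> bool" where
  "essential A \<longleftrightarrow>
     (\<exists>(S :: ('u \<Rightarrow> 'k) set) \<phi>. \<phi> \<in> alg_hom A (power_algebra S) \<and> inj_on \<phi> (carrier A))"

lemma essentialI:
  fixes A :: "('k::field, 'u) module" and S :: "'s set"
  assumes \<phi>: "\<phi> \<in> alg_hom A (power_algebra S)" and inj: "inj_on \<phi> (carrier A)"
    and A: "k_algebra A"
  shows "essential A"
proof -
  interpret algebra "ring_of_type_algebra :: 'k ring" A
    using A by (simp add: k_algebra_def)
  have hom: "\<phi> \<in> ring_hom A (power_algebra S)"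
    and lin: "\<And>c x. x \<in> carrier A \<Longrightarrow> \<phi> (c \<odot>\<^bsub>A\<^esub> x) = c \<odot>\<^bsub>power_algebra S\<^esub> \<phi> x"
    and ext: "\<phi> \<in> carrier A \<rightarrow>\<^sub>E carrier (power_algebra S)"
    using \<phi> by (auto simp: alg_hom_def)
  have sm: "c \<odot>\<^bsub>A\<^esub> x \<in> carrier A" if "x \<in> carrier A" for c :: 'k and x
    using smult_closed[of c x] that by (simp add: ring_of_type_algebra_def)
  define \<chi> where "\<chi> = (\<lambda>s. \<lambda>a\<in>carrier A. \<phi> a s)"
  define T where "T = \<chi> ` S"
  define \<psi> where "\<psi> = (\<lambda>a\<in>carrier A. \<lambda>t\<in>T. t a)"
  have \<psi>_at: "\<psi> a (\<chi> s) = \<phi> a s" if "a \<in> carrier A" "s \<in> S" for a s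
    using that by (simp add: \<psi>_def T_def \<chi>_def)
  have \<psi>_mem: "\<psi> a \<in> T \<rightarrow>\<^sub>E UNIV" if "a \<in> carrier A" for a
    using that by (simp add: \<psi>_def)
  have eqI: "u = v" if "u \<in> T \<rightarrow>\<^sub>E UNIV" "v \<in> T \<rightarrow>\<^sub>E UNIV" "\<And>s. s \<in> S \<Longrightarrow> u (\<chi> s) = v (\<chi> s)"
    for u v :: "('u \<Rightarrow> 'k) \<Rightarrow> 'k"
    by (rule PiE_ext[OF that(1,2)]) (auto simp: T_def that(3))
  have \<chi>T: "\<chi> s \<in> T" if "s \<in> S" for s
    using that by (simp add: T_def)
  have "\<psi> \<in> alg_hom A (power_algebra T)"
    unfolding alg_hom_def
  proof (intro CollectI conjI allI ballI)
    show "\<psi> \<in> carrier A \<rightarrow>\<^sub>E carrier (power_algebra T)"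
      by (auto simp: \<psi>_def power_algebra_def)
    show "\<psi> \<in> ring_hom A (power_algebra T)"
    proof (rule ring_hom_memI)
      show "\<psi> x \<in> carrier (power_algebra T)" if "x \<in> carrier A" for x
        using \<psi>_mem[OF that] by (simp add: power_algebra_def)
      show "\<psi> (x \<otimes>\<^bsub>A\<^esub> y) = \<psi> x \<otimes>\<^bsub>power_algebra T\<^esub> \<psi> y" if "x \<in> carrier A" "y \<in> carrier A" for x y
        using that ring_hom_mult[OF hom that]
        by (intro eqI) (auto simp: \<psi>_mem \<psi>_at \<chi>T power_algebra_def)
      show "\<psi> (x \<oplus>\<^bsub>A\<^esub> y) = \<psi> x \<oplus>\<^bsub>power_algebra T\<^esub> \<psi> y" if "x \<in> carrier A" "y \<in> carrier A" for x y
        using that ring_hom_add[OF hom that]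
        by (intro eqI) (auto simp: \<psi>_mem \<psi>_at \<chi>T power_algebra_def)
      show "\<psi> \<one>\<^bsub>A\<^esub> = \<one>\<^bsub>power_algebra T\<^esub>"
        using ring_hom_one[OF hom]
        by (intro eqI) (auto simp: \<psi>_mem \<psi>_at \<chi>T power_algebra_def)
    qed
    show "\<psi> (c \<odot>\<^bsub>A\<^esub> x) = c \<odot>\<^bsub>power_algebra T\<^esub> \<psi> x" if "x \<in> carrier A" for c x
      using that lin[OF that, of c] sm[OF that, of c]
      by (intro eqI) (auto simp: \<psi>_mem \<psi>_at \<chi>T power_algebra_def)
  qed
  moreover have "inj_on \<psi> (carrier A)"
  proof (rule inj_onI)
    fix a b assume ab: "a \<in> carrier A" "b \<in> carrier A" and eq: "\<psi> a = \<psi> b"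
    have "\<phi> a s = \<phi> b s" if "s \<in> S" for s
      using that ab eq \<psi>_at by metis
    moreover have "\<phi> a \<in> S \<rightarrow>\<^sub>E UNIV" "\<phi> b \<in> S \<rightarrow>\<^sub>E UNIV"
      using ab ext by (auto simp: power_algebra_def)
    ultimately have "\<phi> a = \<phi> b"
      by (meson PiE_ext)
    then show "a = b"
      using inj ab by (simp add: inj_on_eq_iff)
  qed
  ultimately show ?thesis
    unfolding essential_def by blast
qed


section \<open>Polynomials in several variables\<close>

text \<open>
  A monomial is a finitely supported exponent function; the variables are \<open>X\<^sub>0, X\<^sub>1, \<dots>\<close>.
\<close>

type_synonym 'k mpoly = "(nat \<Rightarrow>\<^sub>0 nat) \<Rightarrow>\<^sub>0 'k"

definition poly_algebra :: "nat \<Rightarrow> ('k::field, 'k mpoly) module" where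
  "poly_algebra n = \<lparr>
     carrier = {p. \<forall>m \<in> Poly_Mapping.keys p. Poly_Mapping.keys m \<subseteq> {..<n}},
     monoid.mult = (*), one = 1, ring.zero = 0, add = (+),
     module.smult = (\<lambda>c p. Poly_Mapping.single 0 c * p) \<rparr>"

definition poly_eval :: "'k::field mpoly \<Rightarrow> (nat \<Rightarrow> 'k) \<Rightarrow> 'k" where
  "poly_eval p P = (\<Sum>m \<in> Poly_Mapping.keys p. Poly_Mapping.lookup p m *
     (\<Prod>i \<in> Poly_Mapping.keys m. P i ^ Poly_Mapping.lookup m i))"

definition finite_type :: "('k::field, 'u) module \<Rightarrow> bool" where
  "finite_type A \<longleftrightarrow>
     (\<exists>n. \<exists>\<pi> \<in> alg_hom (poly_algebra n) A. \<pi> ` carrier (poly_algebra n) = carrier A)"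

definition essential_algebras :: "(('k::field, 'u) module, 'u \<Rightarrow> 'u) cat" where
  "essential_algebras = \<lparr>
     Obj = {A. k_algebra A \<and> essential A \<and> finite_type A},
     Hom = alg_hom,
     Id = (\<lambda>A. \<lambda>a\<in>carrier A. a),
     Comp = (\<lambda>A B C h g. compose (carrier A) h g) \<rparr>"


section \<open>Affine algebraic subvarieties\<close>

definition affine_space :: "nat \<Rightarrow> (nat \<Rightarrow> 'k) set" where
  "affine_space n = {..<n} \<rightarrow>\<^sub>E UNIV"

definition zero_set :: "nat \<Rightarrow> 'k::field mpoly set \<Rightarrow> (nat \<Rightarrow> 'k) set" where
  "zero_set n I = {P \<in> affine_space n. \<forall>f \<in> I. poly_eval f P = 0}"

definition algebraic_subset :: "nat \<Rightarrow> (nat \<Rightarrow> 'k::field) set \<Rightarrow> bool" where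
  "algebraic_subset n V \<longleftrightarrow> (\<exists>I. ideal I (poly_algebra n :: ('k, 'k mpoly) module) \<and> V = zero_set n I)"

text \<open>
  A variety is recorded as a pair \<open>(n, V)\<close> with \<open>V \<subseteq> k\<^sup>n\<close>.
\<close>

type_synonym 'k variety = "nat \<times> (nat \<Rightarrow> 'k) set"

definition vanishing_ideal :: "'k::field variety \<Rightarrow> 'k mpoly set" where
  "vanishing_ideal = (\<lambda>(n, V). {f \<in> carrier (poly_algebra n). \<forall>P \<in> V. poly_eval f P = 0})"

definition quotient_algebra :: "('k::field, 'u) module \<Rightarrow> 'u set \<Rightarrow> ('k, 'u set) module" where
  "quotient_algebra A I = \<lparr>
     carrier = carrier (A Quot I), monoid.mult = monoid.mult (A Quot I), one = one (A Quot I),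
     ring.zero = ring.zero (A Quot I), add = add (A Quot I),
     module.smult = (\<lambda>c U. \<Union>x\<in>U. I +>\<^bsub>A\<^esub> (c \<odot>\<^bsub>A\<^esub> x)) \<rparr>"

definition coordinate_algebra :: "'k::field variety \<Rightarrow> ('k, 'k mpoly set) module" where
  "coordinate_algebra V = quotient_algebra (poly_algebra (fst V)) (vanishing_ideal V)"

text \<open>
  The value at a point of \<open>V\<close> of an element of \<open>k[V]\<close>, that is, of a class modulo
  the vanishing ideal: the common value of all the representatives.
\<close>

definition coord_eval :: "'k::field mpoly set \<Rightarrow> (nat \<Rightarrow> 'k) \<Rightarrow> 'k" where
  "coord_eval g P = (THE c. \<forall>p \<in> g. poly_eval p P = c)"

definition regular_maps :: "'k::field variety \<Rightarrow> 'k variety \<Rightarrow> ((nat \<Rightarrow> 'k) \<Rightarrow> (nat \<Rightarrow> 'k)) set" where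
  "regular_maps V W = {f \<in> snd V \<rightarrow>\<^sub>E snd W.
     \<exists>F. (\<forall>i < fst W. F i \<in> carrier (coordinate_algebra V)) \<and>
         (\<forall>P \<in> snd V. \<forall>i < fst W. f P i = coord_eval (F i) P)}"

definition affine_varieties :: "('k::field variety, (nat \<Rightarrow> 'k) \<Rightarrow> (nat \<Rightarrow> 'k)) cat" where
  "affine_varieties = \<lparr>
     Obj = {(n, V). algebraic_subset n V},
     Hom = regular_maps,
     Id = (\<lambda>V. \<lambda>P\<in>snd V. P),
     Comp = (\<lambda>U V W g f. compose (snd U) g f) \<rparr>"


section \<open>The coordinate algebra functor\<close>

text \<open>
  For \<open>f : V \<rightarrow> W\<close>, the map \<open>k[f] : k[W] \<rightarrow> k[V]\<close>, \<open>g \<mapsto> g \<circ> f\<close>, where \<open>g \<circ> f\<close> is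
  the element of \<open>k[V]\<close> whose associated function is \<open>P \<mapsto> g (f P)\<close>.
\<close>

definition coordinate_map :: "'k::field variety \<Rightarrow> 'k variety
    \<Rightarrow> ((nat \<Rightarrow> 'k) \<Rightarrow> (nat \<Rightarrow> 'k)) \<Rightarrow> 'k mpoly set \<Rightarrow> 'k mpoly set" where
  "coordinate_map V W f = (\<lambda>g\<in>carrier (coordinate_algebra W).
     THE h. h \<in> carrier (coordinate_algebra V) \<and>
            (\<forall>P \<in> snd V. coord_eval h P = coord_eval g (f P)))"

text \<open>
  The algebras \<open>k[V]\<close> have carriers over the type \<open>'k mpoly set\<close>.  To compare varieties with
  algebras whose carriers lie in another (for example, larger) type \<open>'u\<close>, one transports algebras and
  homomorphisms along an injection of types \<open>\<iota>\<close>.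
\<close>

definition transport_algebra :: "('a \<Rightarrow> 'u) \<Rightarrow> ('k, 'a) module \<Rightarrow> ('k, 'u) module" where
  "transport_algebra \<iota> A = \<lparr>
     carrier = \<iota> ` carrier A,
     monoid.mult = (\<lambda>x y. \<iota> (inv_into UNIV \<iota> x \<otimes>\<^bsub>A\<^esub> inv_into UNIV \<iota> y)),
     one = \<iota> \<one>\<^bsub>A\<^esub>, ring.zero = \<iota> \<zero>\<^bsub>A\<^esub>,
     add = (\<lambda>x y. \<iota> (inv_into UNIV \<iota> x \<oplus>\<^bsub>A\<^esub> inv_into UNIV \<iota> y)),
     module.smult = (\<lambda>c x. \<iota> (c \<odot>\<^bsub>A\<^esub> inv_into UNIV \<iota> x)) \<rparr>"

definition transport_hom :: "('a \<Rightarrow> 'u) \<Rightarrow> ('k, 'a) module \<Rightarrow> ('a \<Rightarrow> 'a) \<Rightarrow> 'u \<Rightarrow> 'u" where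
  "transport_hom \<iota> A h = (\<lambda>x\<in>\<iota> ` carrier A. \<iota> (h (inv_into UNIV \<iota> x)))"

end

theory Submission
  imports Defs
begin

text \<open>
  The functor is shown to be fully faithful and essentially surjective. An algebra homomorphism
  \<open>k[X\<^sub>1, \<dots>, X\<^sub>m] \<rightarrow> k\<close> is the evaluation at the point formed by the images of the variables. Applied
  to \<open>p \<mapsto> h([p])(P)\<close> for \<open>h : k[W] \<rightarrow> k[V]\<close> and \<open>P \<in> V\<close>, this yields the point \<open>f(P)\<close> of the
  regular map inducing \<open>h\<close>; it lies in \<open>W\<close> because the equations of \<open>W\<close> are zero in \<open>k[W]\<close>.
  Given a surjection \<open>\<pi>\<close> from \<open>k[X\<^sub>1, \<dots>, X\<^sub>n]\<close> onto \<open>A\<close> and an embedding of \<open>A\<close> into \<open>k\<^sup>S\<close>, let \<open>V\<close> be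
  the zero set of \<open>ker \<pi>\<close>. Each \<open>s \<in> S\<close> gives a point of \<open>V\<close>, so a polynomial vanishing on \<open>V\<close> has
  zero image in \<open>k\<^sup>S\<close>, hence lies in \<open>ker \<pi>\<close>; thus \<open>k[V]\<close> is isomorphic to \<open>A\<close>.
\<close>

section \<open>Fully faithful and essentially surjective functors\<close>

lemma category_op_cat:
  assumes "category C"
  shows "category (op_cat C)"
proof -
  interpret category C by fact
  show ?thesis
    by unfold_locales
      (auto simp: op_cat_def Id_closed Comp_closed Comp_Id_left Comp_Id_right Comp_assoc)
qed

context category
begin

text \<open>Cancels a pair \<open>u' u = Id\<close> in the middle of a composite of four arrows. It
  is applied with \<open>u = e' B\<close> and \<open>u' = e B\<close>, where two conjugated arrows
  meet.\<close>

lemma Comp_cancel_middle: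
  assumes "W \<in> Obj C" "V \<in> Obj C" "Y \<in> Obj C" "Z \<in> Obj C"
    and "f \<in> Hom C W V" "u \<in> Hom C V Y" "u' \<in> Hom C Y V" "g \<in> Hom C V Z"
    and "Comp C V Y V u' u = Id C V"
  shows "Comp C W Y Z (Comp C Y V Z g u') (Comp C W V Y u f) = Comp C W V Z g f"
proof -
  have "Comp C W Y Z (Comp C Y V Z g u') (Comp C W V Y u f)
      = Comp C W V Z (Comp C V Y Z (Comp C Y V Z g u') u) f"
    using assms Comp_assoc[of W V Y Z f u "Comp C Y V Z g u'"] by (simp add: Comp_closed)
  also have "Comp C V Y Z (Comp C Y V Z g u') u = g"
    using assms by (simp add: Comp_assoc Comp_Id_right)
  finally show ?thesis .
qed

end

text \<open>The quasi-inverse is built by choice: \<open>G A\<close> is an object with an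
  isomorphism \<open>e A : Fo (G A) -> A\<close>, and an arrow \<open>h\<close> goes to the lift
  through \<open>Fm\<close> of its conjugate by these isomorphisms. Equations between arrows of
  \<open>C\<close> are checked after applying \<open>Fm\<close>, which suffices by
  faithfulness.\<close>

lemma cat_equivalenceI:
  assumes F: "cat_functor C D Fo Fm"
    and faithful: "\<And>V Y f g. \<lbrakk>V \<in> Obj C; Y \<in> Obj C; f \<in> Hom C V Y; g \<in> Hom C V Y;
          Fm V Y f = Fm V Y g\<rbrakk> \<Longrightarrow> f = g"
    and full: "\<And>V Y h. \<lbrakk>V \<in> Obj C; Y \<in> Obj C; h \<in> Hom D (Fo V) (Fo Y)\<rbrakk>
          \<Longrightarrow> \<exists>f \<in> Hom C V Y. Fm V Y f = h"
    and surj: "\<And>A. A \<in> Obj D \<Longrightarrow> \<exists>V \<in> Obj C. \<exists>e. iso_arrow D (Fo V) A e"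
  shows "cat_equivalence C D Fo Fm"
proof -
  interpret cat_functor C D Fo Fm by fact
  define lift where "lift V Y h = (SOME f. f \<in> Hom C V Y \<and> Fm V Y f = h)" for V Y h
  have lift: "lift V Y h \<in> Hom C V Y" "Fm V Y (lift V Y h) = h"
    if "V \<in> Obj C" "Y \<in> Obj C" "h \<in> Hom D (Fo V) (Fo Y)" for V Y h
    using someI_ex[of "\<lambda>f. f \<in> Hom C V Y \<and> Fm V Y f = h"] full[OF that]
    unfolding lift_def by blast+
  have "\<forall>A \<in> Obj D. \<exists>V e e'. V \<in> Obj C \<and> e \<in> Hom D (Fo V) A \<and> e' \<in> Hom D A (Fo V) \<and>
      Comp D (Fo V) A (Fo V) e' e = Id D (Fo V) \<and> Comp D A (Fo V) A e e' = Id D A"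
    using surj unfolding iso_arrow_def by blast
  then obtain G e e' where G: "\<And>A. A \<in> Obj D \<Longrightarrow> G A \<in> Obj C"
    and e: "\<And>A. A \<in> Obj D \<Longrightarrow> e A \<in> Hom D (Fo (G A)) A"
    and e': "\<And>A. A \<in> Obj D \<Longrightarrow> e' A \<in> Hom D A (Fo (G A))"
    and e'e: "\<And>A. A \<in> Obj D \<Longrightarrow> Comp D (Fo (G A)) A (Fo (G A)) (e' A) (e A) = Id D (Fo (G A))"
    and ee': "\<And>A. A \<in> Obj D \<Longrightarrow> Comp D A (Fo (G A)) A (e A) (e' A) = Id D A"
    by metis
  define conj where "conj A B h =
    Comp D (Fo (G A)) B (Fo (G B)) (e' B) (Comp D (Fo (G A)) A B h (e A))" for A B h
  define Gm where "Gm A B h = lift (G A) (G B) (conj A B h)" for A B h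
  note closed = G e e' Fo_closed Fm_closed dom.Comp_closed cod.Comp_closed dom.Id_closed cod.Id_closed
  have conj: "conj A B h \<in> Hom D (Fo (G A)) (Fo (G B))"
    if "A \<in> Obj D" "B \<in> Obj D" "h \<in> Hom D A B" for A B h
    using that unfolding conj_def by (meson closed)
  have Gm: "Gm A B h \<in> Hom C (G A) (G B)" "Fm (G A) (G B) (Gm A B h) = conj A B h"
    if "A \<in> Obj D" "B \<in> Obj D" "h \<in> Hom D A B" for A B h
    using that unfolding Gm_def by (auto intro!: lift G conj)
  \<comment> \<open>This bracketing has \<open>e A\<close> as the outer factor on the right, whereas
    the definition has \<open>e' B\<close> on the left. Using one form for each factor of a
    composite makes \<open>e B\<close> and \<open>e' B\<close> adjacent.\<close>
  have conj_assoc: "conj A B h =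
      Comp D (Fo (G A)) A (Fo (G B)) (Comp D A B (Fo (G B)) (e' B) h) (e A)"
    if "A \<in> Obj D" "B \<in> Obj D" "h \<in> Hom D A B" for A B h
    using that unfolding conj_def by (subst cod.Comp_assoc) (auto intro: closed)
  have conj_Id: "conj A A (Id D A) = Id D (Fo (G A))" if "A \<in> Obj D" for A
    using that by (simp add: conj_def cod.Comp_Id_left closed e'e)
  have conj_Comp: "conj A E (Comp D A B E h' h) =
      Comp D (Fo (G A)) (Fo (G B)) (Fo (G E)) (conj B E h') (conj A B h)"
    if "A \<in> Obj D" "B \<in> Obj D" "E \<in> Obj D" "h \<in> Hom D A B" "h' \<in> Hom D B E" for A B E h h'
  proof -
    have "Comp D (Fo (G A)) (Fo (G B)) (Fo (G E)) (conj B E h') (conj A B h)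
      = Comp D (Fo (G A)) B (Fo (G E)) (Comp D B E (Fo (G E)) (e' E) h')
          (Comp D (Fo (G A)) A B h (e A))"
      unfolding conj_assoc[OF that(2,3,5)] unfolding conj_def
      using that by (intro cod.Comp_cancel_middle) (auto intro: closed ee')
    also have "\<dots> = conj A E (Comp D A B E h' h)"
      using that by (simp add: conj_def cod.Comp_assoc closed)
    finally show ?thesis by simp
  qed
  have natural: "Comp D (Fo (G A)) (Fo (G B)) B (e B) (conj A B h) = Comp D (Fo (G A)) A B h (e A)"
    if "A \<in> Obj D" "B \<in> Obj D" "h \<in> Hom D A B" for A B h
  proof -
    have "Comp D (Fo (G A)) (Fo (G B)) B (e B) (conj A B h)
       = Comp D (Fo (G A)) B B (Comp D B (Fo (G B)) B (e B) (e' B)) (Comp D (Fo (G A)) A B h (e A))"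
      using that unfolding conj_def by (subst cod.Comp_assoc) (auto intro: closed)
    with that show ?thesis by (simp add: ee' cod.Comp_Id_left closed)
  qed
  have "cat_functor D C G Gm"
  proof unfold_locales
    fix A B E h h'
    assume *: "A \<in> Obj D" "B \<in> Obj D" "E \<in> Obj D" "h \<in> Hom D A B" "h' \<in> Hom D B E"
    show "Gm A E (Comp D A B E h' h) = Comp C (G A) (G B) (G E) (Gm B E h') (Gm A B h)"
      by (rule faithful[of "G A" "G E"])
        (use * in \<open>simp_all add: G Gm closed Fm_Comp conj_Comp\<close>)
  next
    fix A assume "A \<in> Obj D"
    then show "Gm A A (Id D A) = Id C (G A)"
      by (intro faithful[of "G A" "G A"]) (simp_all add: Gm closed Fm_Id conj_Id)
  qed (simp_all add: G Gm)
  moreover have "naturally_isomorphic D D (\<lambda>A. Fo (G A)) (\<lambda>A B h. Fm (G A) (G B) (Gm A B h))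
          (\<lambda>A. A) (\<lambda>A B h. h)"
    unfolding naturally_isomorphic_def iso_arrow_def
    by (intro exI[of _ e]) (auto simp: e Gm natural intro!: e'e ee' e' bexI[of _ "e' _"])
  moreover have "naturally_isomorphic C C (\<lambda>U. G (Fo U)) (\<lambda>U Y f. Gm (Fo U) (Fo Y) (Fm U Y f))
          (\<lambda>U. U) (\<lambda>U Y f. f)"
  proof -
    \<comment> \<open>The arrow \<open>e (Fo U)\<close> runs between images of objects of
      \<open>C\<close>, so fullness lifts it and its inverse; by faithfulness the two lifts are
      again mutually inverse.\<close>
    define \<eta> where "\<eta> U = lift (G (Fo U)) U (e (Fo U))" for U
    define \<eta>' where "\<eta>' U = lift U (G (Fo U)) (e' (Fo U))" for U
    have \<eta>: "\<eta> U \<in> Hom C (G (Fo U)) U" "Fm (G (Fo U)) U (\<eta> U) = e (Fo U)" if "U \<in> Obj C" for U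
      using that unfolding \<eta>_def by (auto intro!: lift closed)
    have \<eta>': "\<eta>' U \<in> Hom C U (G (Fo U))" "Fm U (G (Fo U)) (\<eta>' U) = e' (Fo U)" if "U \<in> Obj C" for U
      using that unfolding \<eta>'_def by (auto intro!: lift closed)
    have "iso_arrow C (G (Fo U)) U (\<eta> U)" if "U \<in> Obj C" for U
      unfolding iso_arrow_def
    proof (intro conjI bexI)
      show "Comp C (G (Fo U)) U (G (Fo U)) (\<eta>' U) (\<eta> U) = Id C (G (Fo U))"
        by (rule faithful[of "G (Fo U)" "G (Fo U)"])
          (use that in \<open>simp_all add: closed Fm_Comp Fm_Id \<eta> \<eta>' e'e\<close>)
      show "Comp C U (G (Fo U)) U (\<eta> U) (\<eta>' U) = Id C U"
        by (rule faithful[of U U]) (use that in \<open>simp_all add: closed Fm_Comp Fm_Id \<eta> \<eta>' ee'\<close>)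
    qed (use that in \<open>simp_all add: \<eta> \<eta>'\<close>)
    moreover have "Comp C (G (Fo U)) (G (Fo Y)) Y (\<eta> Y) (Gm (Fo U) (Fo Y) (Fm U Y f))
        = Comp C (G (Fo U)) U Y f (\<eta> U)"
      if "U \<in> Obj C" "Y \<in> Obj C" "f \<in> Hom C U Y" for U Y f
      by (rule faithful[of "G (Fo U)" Y])
        (use that in \<open>simp_all add: closed Gm Fm_Comp \<eta> natural\<close>)
    ultimately show ?thesis
      unfolding naturally_isomorphic_def by blast
  qed
  ultimately show ?thesis
    unfolding cat_equivalence_def using F by blast
qed

section \<open>Evaluation of polynomials\<close>

text \<open>Reduces claims on polynomials to single terms. Exponent functions are also of type
  \<open>poly_mapping\<close>, so the same expansion splits a monomial into powers of
  variables.\<close>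

lemma poly_mapping_sum_single:
  "p = (\<Sum>m\<in>Poly_Mapping.keys p. Poly_Mapping.single m (Poly_Mapping.lookup p m))"
proof (rule poly_mapping_eqI)
  fix k
  have "(\<Sum>m\<in>Poly_Mapping.keys p. Poly_Mapping.lookup p m when m = k)
      = (\<Sum>m\<in>Poly_Mapping.keys p. if m = k then Poly_Mapping.lookup p k else 0)"
    by (intro sum.cong) (auto simp: when_def)
  then have "(\<Sum>m\<in>Poly_Mapping.keys p. Poly_Mapping.lookup p m when m = k) = Poly_Mapping.lookup p k"
    by (simp add: in_keys_iff)
  then show "Poly_Mapping.lookup p k = Poly_Mapping.lookup
      (\<Sum>m\<in>Poly_Mapping.keys p. Poly_Mapping.single m (Poly_Mapping.lookup p m)) k"
    by (simp add: lookup_sum lookup_single)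
qed

definition monom_eval :: "(nat \<Rightarrow>\<^sub>0 nat) \<Rightarrow> (nat \<Rightarrow> 'k::field) \<Rightarrow> 'k" where
  "monom_eval m P = (\<Prod>i \<in> Poly_Mapping.keys m. P i ^ Poly_Mapping.lookup m i)"

lemma monom_eval_add: "monom_eval (m + m') P = monom_eval m P * monom_eval m' P"
proof -
  let ?A = "Poly_Mapping.keys m \<union> Poly_Mapping.keys m'"
  \<comment> \<open>The three products run over different supports. They are extended to one common
    index set, where each added factor is a zeroth power.\<close>
  have ext: "monom_eval l P = (\<Prod>i\<in>?A. P i ^ Poly_Mapping.lookup l i)"
    if "Poly_Mapping.keys l \<subseteq> ?A" for l
    unfolding monom_eval_def using that
    by (intro prod.mono_neutral_left) (auto simp: in_keys_iff)
  show ?thesis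
    using ext[of "m + m'"] ext[of m] ext[of m'] keys_add[of m m']
    by (simp add: lookup_add power_add prod.distrib)
qed

lemma poly_eval_alt:
  "poly_eval p P = (\<Sum>m \<in> Poly_Mapping.keys p. Poly_Mapping.lookup p m * monom_eval m P)"
  by (simp add: poly_eval_def monom_eval_def)

lemma poly_eval_single: "poly_eval (Poly_Mapping.single m c) P = c * monom_eval m P"
  by (simp add: poly_eval_alt)

lemma poly_eval_0 [simp]: "poly_eval 0 P = 0"
  by (simp add: poly_eval_alt)

lemma poly_eval_add [simp]: "poly_eval (p + q) P = poly_eval p P + poly_eval q P"
  unfolding poly_eval_alt by (rule setsum_keys_plus_distrib) (auto simp: algebra_simps)

lemma poly_eval_sum: "poly_eval (sum f A) P = (\<Sum>a\<in>A. poly_eval (f a) P)"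
  by (induction A rule: infinite_finite_induct) auto

lemma poly_eval_diff [simp]: "poly_eval (p - q) P = poly_eval p P - poly_eval q P"
  using poly_eval_add[of "p - q" q P] by (simp add: algebra_simps)

lemma poly_eval_mult [simp]: "poly_eval (p * q) P = poly_eval p P * poly_eval q P"
proof -
  have single: "poly_eval (Poly_Mapping.single m c * Poly_Mapping.single m' c') P
      = poly_eval (Poly_Mapping.single m c) P * poly_eval (Poly_Mapping.single m' c') P" for m c m' c'
    by (simp add: mult_single poly_eval_single monom_eval_add)
  show ?thesis
    \<comment> \<open>The claim for the two expansions is transferred to \<open>p\<close> and
      \<open>q\<close> by congruence, because rewriting with the expansion, whose right side
      contains \<open>p\<close> again, would not terminate.\<close>
    using arg_cong2[of _ _ _ _ "\<lambda>p q. poly_eval (p * q) P = poly_eval p P * poly_eval q P",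
        OF poly_mapping_sum_single[of p] poly_mapping_sum_single[of q]]
    by (simp add: sum_product poly_eval_sum single)
qed

section \<open>Constants, variables and the polynomials in the first n variables\<close>

definition mpoly_const :: "'k::field \<Rightarrow> 'k mpoly" where
  "mpoly_const c = Poly_Mapping.single 0 c"

definition mpoly_var :: "nat \<Rightarrow> 'k::field mpoly" where
  "mpoly_var i = Poly_Mapping.single (Poly_Mapping.single i 1) 1"

lemma poly_eval_const [simp]: "poly_eval (mpoly_const c) P = c"
  by (simp add: mpoly_const_def poly_eval_single monom_eval_def)

lemma poly_eval_var [simp]: "poly_eval (mpoly_var i) P = P i"
  by (simp add: mpoly_var_def poly_eval_single monom_eval_def)

lemma mpoly_const_1: "mpoly_const 1 = 1"
  by (simp add: mpoly_const_def)

lemma mpoly_const_mult: "mpoly_const (c * d) = mpoly_const c * mpoly_const d"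
  by (simp add: mpoly_const_def mult_single)

lemma mpoly_const_add: "mpoly_const (c + d) = mpoly_const c + mpoly_const d"
  by (simp add: mpoly_const_def single_add)

lemma poly_eval_1 [simp]: "poly_eval 1 P = 1"
  using poly_eval_const[of 1 P] by (simp only: mpoly_const_1)

definition polys :: "nat \<Rightarrow> 'k::field mpoly set" where
  "polys n = {p. \<forall>m \<in> Poly_Mapping.keys p. Poly_Mapping.keys m \<subseteq> {..<n}}"

lemma poly_algebra_simps [simp]:
  "carrier (poly_algebra n) = polys n"
  "p \<otimes>\<^bsub>poly_algebra n\<^esub> q = p * q" "\<one>\<^bsub>poly_algebra n\<^esub> = 1"
  "\<zero>\<^bsub>poly_algebra n\<^esub> = 0" "p \<oplus>\<^bsub>poly_algebra n\<^esub> q = p + q"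
  "c \<odot>\<^bsub>poly_algebra n\<^esub> p = mpoly_const c * p"
  by (simp_all add: poly_algebra_def polys_def mpoly_const_def)

lemma polys_add [simp]: "\<lbrakk>p \<in> polys n; q \<in> polys n\<rbrakk> \<Longrightarrow> p + q \<in> polys n"
  unfolding polys_def using keys_add[of p q] by blast

lemma polys_diff [simp]: "\<lbrakk>p \<in> polys n; q \<in> polys n\<rbrakk> \<Longrightarrow> p - q \<in> polys n"
  unfolding polys_def using keys_diff[of p q] by blast

lemma polys_mult [simp]: "p * q \<in> polys n" if p: "p \<in> polys n" and q: "q \<in> polys n"
  unfolding polys_def
proof safe
  fix m i assume "m \<in> Poly_Mapping.keys (p * q)" and i: "i \<in> Poly_Mapping.keys m"
  then obtain a b where "a \<in> Poly_Mapping.keys p" "b \<in> Poly_Mapping.keys q" "m = a + b"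
    using keys_mult[of p q] by blast
  with p q i keys_add[of a b] have "i \<in> {..<n}" unfolding polys_def by blast
  then show "i < n" by simp
qed

lemma polys_const [simp]: "mpoly_const c \<in> polys n"
  by (simp add: polys_def mpoly_const_def)

lemma polys_0 [simp]: "0 \<in> polys n"
  by (simp add: polys_def)

lemma polys_1 [simp]: "1 \<in> polys n"
  by (simp add: polys_def)

lemma polys_var [simp]: "i < n \<Longrightarrow> mpoly_var i \<in> polys n"
  by (simp add: polys_def mpoly_var_def)

text \<open>Constants and variables generate all polynomials: powers of a variable are iterated
  products, monomials are products of such powers, and a polynomial is a sum of constants times
  monomials. Membership is carried along in \<open>?Q\<close> because the cases \<open>add\<close>
  and \<open>mult\<close> ask for it.\<close>

lemma polys_induct [consumes 1, case_names const var add mult]: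
  assumes p: "p \<in> polys n"
    and const: "\<And>c. Q (mpoly_const c)"
    and var: "\<And>i. i < n \<Longrightarrow> Q (mpoly_var i)"
    and add: "\<And>p q. \<lbrakk>p \<in> polys n; q \<in> polys n; Q p; Q q\<rbrakk> \<Longrightarrow> Q (p + q)"
    and mult: "\<And>p q. \<lbrakk>p \<in> polys n; q \<in> polys n; Q p; Q q\<rbrakk> \<Longrightarrow> Q (p * q)"
  shows "Q p"
proof -
  let ?Q = "\<lambda>p. p \<in> polys n \<and> Q p"
  have sum: "?Q (sum f A)" if "\<And>a. a \<in> A \<Longrightarrow> ?Q (f a)" "finite A" for f and A :: "(nat \<Rightarrow>\<^sub>0 nat) set"
    using that(2,1)
  proof (induction A rule: finite_induct)
    case empty
    show ?case using const[of 0] by (simp add: mpoly_const_def)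
  qed (auto intro: add)
  have power: "?Q (Poly_Mapping.single (Poly_Mapping.single i k) 1)" if "i < n" for i k
  proof (induction k)
    case 0
    show ?case using const[of 1] by (simp add: mpoly_const_def)
  next
    case (Suc k)
    have "Poly_Mapping.single (Poly_Mapping.single i (Suc k)) (1::'a)
        = mpoly_var i * Poly_Mapping.single (Poly_Mapping.single i k) 1"
      by (simp add: mpoly_var_def mult_single flip: single_add)
    with Suc that show ?case by (auto intro: mult var)
  qed
  have monoms: "?Q (Poly_Mapping.single (\<Sum>i\<in>A. Poly_Mapping.single i (g i)) 1)"
    if "finite A" "A \<subseteq> {..<n}" for A g
    using that
  proof (induction A rule: finite_induct)
    case empty
    show ?case using const[of 1] by (simp add: mpoly_const_def)
  next
    case (insert i A)
    have "Poly_Mapping.single (\<Sum>i\<in>insert i A. Poly_Mapping.single i (g i)) (1::'a)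
      = Poly_Mapping.single (Poly_Mapping.single i (g i)) 1
        * Poly_Mapping.single (\<Sum>i\<in>A. Poly_Mapping.single i (g i)) 1"
      using insert by (simp add: mult_single)
    with insert power show ?case by (auto intro: mult)
  qed
  have "?Q (Poly_Mapping.single m c)" if "Poly_Mapping.keys m \<subseteq> {..<n}" for m c
  proof -
    have "Poly_Mapping.single m c = mpoly_const c * Poly_Mapping.single m 1"
      by (simp add: mpoly_const_def mult_single)
    moreover have "?Q (Poly_Mapping.single m 1)"
      using monoms[OF finite_keys that, of "Poly_Mapping.lookup m"]
      by (simp flip: poly_mapping_sum_single)
    ultimately show ?thesis by (auto intro: mult const)
  qed
  then have "?Q (\<Sum>m\<in>Poly_Mapping.keys p. Poly_Mapping.single m (Poly_Mapping.lookup p m))"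
    using p by (intro sum) (auto simp: polys_def)
  then show ?thesis by (simp flip: poly_mapping_sum_single)
qed

text \<open>Uniqueness in the universal property of the polynomial algebra. Equations for a bare
  function \<open>\<chi>\<close> are assumed, so that it applies directly to composites such as
  \<open>p \<mapsto> val (h (cls W p)) P\<close>.\<close>

lemma hom_eq_poly_eval:
  assumes "p \<in> polys n" and "\<chi> 1 = 1"
    and "\<And>c p. p \<in> polys n \<Longrightarrow> \<chi> (mpoly_const c * p) = c * \<chi> p"
    and "\<And>p q. \<lbrakk>p \<in> polys n; q \<in> polys n\<rbrakk> \<Longrightarrow> \<chi> (p + q) = \<chi> p + \<chi> q"
    and "\<And>p q. \<lbrakk>p \<in> polys n; q \<in> polys n\<rbrakk> \<Longrightarrow> \<chi> (p * q) = \<chi> p * \<chi> q"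
    and "\<And>i. i < n \<Longrightarrow> \<chi> (mpoly_var i) = P i"
  shows "\<chi> p = poly_eval p P"
  using assms(1)
proof (induction rule: polys_induct)
  case (const c)
  show ?case using assms(3)[of 1 c] assms(2) by simp
qed (use assms in auto)

text \<open>
  The ring \<open>'r\<close> may differ from \<open>k\<close> because over a finite field polynomials are not determined
  by their values; the polynomial algebra is embedded into itself, with \<open>j\<close> the constants.
\<close>

lemma k_algebraI:
  fixes A :: "('k::field, 'u) module" and ev :: "'u \<Rightarrow> 's \<Rightarrow> 'r::comm_ring_1" and j :: "'k \<Rightarrow> 'r"
  assumes one: "\<one>\<^bsub>A\<^esub> \<in> carrier A" and zero: "\<zero>\<^bsub>A\<^esub> \<in> carrier A"
    and mult: "\<And>x y. \<lbrakk>x \<in> carrier A; y \<in> carrier A\<rbrakk> \<Longrightarrow> x \<otimes>\<^bsub>A\<^esub> y \<in> carrier A"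
    and add: "\<And>x y. \<lbrakk>x \<in> carrier A; y \<in> carrier A\<rbrakk> \<Longrightarrow> x \<oplus>\<^bsub>A\<^esub> y \<in> carrier A"
    and smult: "\<And>c x. x \<in> carrier A \<Longrightarrow> c \<odot>\<^bsub>A\<^esub> x \<in> carrier A"
    and eqI: "\<And>x y. \<lbrakk>x \<in> carrier A; y \<in> carrier A; \<And>s. s \<in> S \<Longrightarrow> ev x s = ev y s\<rbrakk> \<Longrightarrow> x = y"
    and ev: "\<And>s. s \<in> S \<Longrightarrow> ev \<one>\<^bsub>A\<^esub> s = 1" "\<And>s. s \<in> S \<Longrightarrow> ev \<zero>\<^bsub>A\<^esub> s = 0"
      "\<And>x y s. \<lbrakk>x \<in> carrier A; y \<in> carrier A; s \<in> S\<rbrakk> \<Longrightarrow> ev (x \<otimes>\<^bsub>A\<^esub> y) s = ev x s * ev y s"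
      "\<And>x y s. \<lbrakk>x \<in> carrier A; y \<in> carrier A; s \<in> S\<rbrakk> \<Longrightarrow> ev (x \<oplus>\<^bsub>A\<^esub> y) s = ev x s + ev y s"
      "\<And>c x s. \<lbrakk>x \<in> carrier A; s \<in> S\<rbrakk> \<Longrightarrow> ev (c \<odot>\<^bsub>A\<^esub> x) s = j c * ev x s"
    and j: "j 1 = 1" "\<And>c d. j (c + d) = j c + j d" "\<And>c d. j (c * d) = j c * j d"
  shows "k_algebra A"
proof -
  note [simp] = one zero mult add smult ev j
  have j0: "j 0 = 0" using j(2)[of 0 0] by simp
  have jm: "j (- 1) = - 1" using j(2)[of "- 1" 1] j0 by (simp add: eq_neg_iff_add_eq_0)
  \<comment> \<open>Only the ring operations and scalars are given, so the additive inverse is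
    obtained as the multiple by the scalar -1.\<close>
  have neg: "\<exists>y \<in> carrier A. y \<oplus>\<^bsub>A\<^esub> x = \<zero>\<^bsub>A\<^esub>" if "x \<in> carrier A" for x
    using that by (intro bexI[of _ "(- 1) \<odot>\<^bsub>A\<^esub> x"] eqI) (auto simp: jm)
  \<comment> \<open>The remaining laws are equations; \<open>eqI\<close> moves them to the
    commutative ring \<open>'r\<close>, where they hold.\<close>
  have ab: "abelian_group A"
    by (rule abelian_groupI) (auto intro!: eqI neg simp: algebra_simps)
  have cr: "cring A"
    by (intro cringI ab comm_monoidI) (auto intro!: eqI simp: algebra_simps)
  show ?thesis
    unfolding k_algebra_def
    by (intro algebraI cring_from_type_algebra cr)
      (auto intro!: eqI simp: ring_of_type_algebra_def algebra_simps)
qed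

lemma k_algebra_poly_algebra: "k_algebra (poly_algebra n :: ('k::field, 'k mpoly) module)"
  by (rule k_algebraI[where S = "{()}" and ev = "\<lambda>p _. p" and j = mpoly_const])
    (auto simp: mpoly_const_1 mpoly_const_add mpoly_const_mult)

section \<open>Coordinate algebras\<close>

text \<open>The coset of \<open>p\<close> modulo the vanishing ideal, written through values on
  \<open>V\<close> so that two classes agree exactly when the functions on \<open>V\<close>
  do.\<close>

definition poly_class :: "'k::field variety \<Rightarrow> 'k mpoly \<Rightarrow> 'k mpoly set" where
  "poly_class V p = {q \<in> polys (fst V). \<forall>P\<in>snd V. poly_eval q P = poly_eval p P}"

lemma vanishing_ideal_eq: "vanishing_ideal V = poly_class V 0"
  by (cases V) (simp add: vanishing_ideal_def poly_class_def)

lemma poly_class_self [simp]: "p \<in> polys (fst V) \<Longrightarrow> p \<in> poly_class V p"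
  by (simp add: poly_class_def)

lemma poly_class_eq_iff:
  "\<lbrakk>p \<in> polys (fst V); q \<in> polys (fst V)\<rbrakk> \<Longrightarrow>
    poly_class V p = poly_class V q \<longleftrightarrow> (\<forall>P\<in>snd V. poly_eval p P = poly_eval q P)"
  by (auto simp: poly_class_def)

lemma vanishing_coset:
  assumes "p \<in> polys (fst V)"
  shows "vanishing_ideal V +>\<^bsub>poly_algebra (fst V)\<^esub> p = poly_class V p"
proof (rule Set.set_eqI)
  fix x
  show "x \<in> vanishing_ideal V +>\<^bsub>poly_algebra (fst V)\<^esub> p \<longleftrightarrow> x \<in> poly_class V p"
  proof
    assume "x \<in> poly_class V p"
    with assms have "x - p \<in> vanishing_ideal V" "x = (x - p) + p"
      by (auto simp: vanishing_ideal_eq poly_class_def)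
    then show "x \<in> vanishing_ideal V +>\<^bsub>poly_algebra (fst V)\<^esub> p"
      unfolding a_r_coset_def' by (auto intro!: bexI[of _ "x - p"])
  qed (use assms in \<open>auto simp: a_r_coset_def' vanishing_ideal_eq poly_class_def\<close>)
qed

lemma coordinate_algebra_carrier:
  "carrier (coordinate_algebra V) = poly_class V ` polys (fst V)"
  by (auto simp: coordinate_algebra_def quotient_algebra_def FactRing_def A_RCOSETS_def' vanishing_coset)

lemma coordinate_algebra_zero: "\<zero>\<^bsub>coordinate_algebra V\<^esub> = poly_class V 0"
  by (simp add: coordinate_algebra_def quotient_algebra_def FactRing_def vanishing_ideal_eq)

lemma coordinate_algebra_one: "\<one>\<^bsub>coordinate_algebra V\<^esub> = poly_class V 1"
  by (simp add: coordinate_algebra_def quotient_algebra_def FactRing_def vanishing_coset)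

lemma coordinate_algebra_add:
  assumes "p \<in> polys (fst V)" "q \<in> polys (fst V)"
  shows "poly_class V p \<oplus>\<^bsub>coordinate_algebra V\<^esub> poly_class V q = poly_class V (p + q)"
proof -
  have "poly_class V p <+>\<^bsub>poly_algebra (fst V)\<^esub> poly_class V q = poly_class V (p + q)"
  proof (rule Set.set_eqI, rule iffI)
    fix x assume "x \<in> poly_class V (p + q)"
    with assms have "x - q \<in> poly_class V p" "x = (x - q) + q"
      by (auto simp: poly_class_def)
    with assms show "x \<in> poly_class V p <+>\<^bsub>poly_algebra (fst V)\<^esub> poly_class V q"
      unfolding set_add_def' poly_algebra_simps
      by (metis (no_types, lifting) UN_iff poly_class_self singletonI)
  qed (use assms in \<open>auto simp: set_add_def' poly_class_def\<close>)
  then show ?thesis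
    by (simp add: coordinate_algebra_def quotient_algebra_def FactRing_def)
qed

text \<open>The product in the quotient is a union over all pairs of representatives. Every pair
  gives the same coset and both classes are nonempty, so the union is that coset.\<close>

lemma coordinate_algebra_mult:
  assumes "p \<in> polys (fst V)" "q \<in> polys (fst V)"
  shows "poly_class V p \<otimes>\<^bsub>coordinate_algebra V\<^esub> poly_class V q = poly_class V (p * q)"
proof -
  have "vanishing_ideal V +>\<^bsub>poly_algebra (fst V)\<^esub> (a * b) = poly_class V (p * q)"
    if "a \<in> poly_class V p" "b \<in> poly_class V q" for a b
    using that by (subst vanishing_coset) (auto simp: poly_class_def)
  then have "(\<Union>a\<in>poly_class V p. \<Union>b\<in>poly_class V q.
      vanishing_ideal V +>\<^bsub>poly_algebra (fst V)\<^esub> (a * b)) = poly_class V (p * q)"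
    using poly_class_self[OF assms(1)] poly_class_self[OF assms(2)] by blast
  then show ?thesis
    by (simp add: coordinate_algebra_def quotient_algebra_def FactRing_def rcoset_mult_def)
qed

lemma coordinate_algebra_smult:
  assumes "p \<in> polys (fst V)"
  shows "c \<odot>\<^bsub>coordinate_algebra V\<^esub> poly_class V p = poly_class V (mpoly_const c * p)"
proof -
  have "vanishing_ideal V +>\<^bsub>poly_algebra (fst V)\<^esub> (mpoly_const c * a) = poly_class V (mpoly_const c * p)"
    if "a \<in> poly_class V p" for a
    using that by (subst vanishing_coset) (auto simp: poly_class_def)
  then have "(\<Union>a\<in>poly_class V p.
      vanishing_ideal V +>\<^bsub>poly_algebra (fst V)\<^esub> (mpoly_const c * a)) = poly_class V (mpoly_const c * p)"
    using poly_class_self[OF assms(1)] by blast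
  then show ?thesis
    by (simp add: coordinate_algebra_def quotient_algebra_def)
qed

lemma coord_eval_class:
  assumes "p \<in> polys (fst V)" "P \<in> snd V"
  shows "coord_eval (poly_class V p) P = poly_eval p P"
  unfolding coord_eval_def
proof (rule the_equality)
  show "\<forall>q\<in>poly_class V p. poly_eval q P = poly_eval p P"
    using assms by (simp add: poly_class_def)
  show "c = poly_eval p P" if "\<forall>q\<in>poly_class V p. poly_eval q P = c" for c
    using bspec[OF that poly_class_self[OF assms(1)]] by simp
qed

section \<open>The category of varieties\<close>

text \<open>Choosing a representative of each coordinate function replaces
  \<open>coord_eval\<close>, which is a definite description, by evaluation of polynomials.\<close>

lemma regular_maps_iff:
  "f \<in> regular_maps V W \<longleftrightarrow> f \<in> snd V \<rightarrow>\<^sub>E snd W \<and>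
     (\<exists>p. \<forall>i < fst W. p i \<in> polys (fst V) \<and> (\<forall>P \<in> snd V. f P i = poly_eval (p i) P))"
  (is "_ \<longleftrightarrow> _ \<and> ?R")
proof -
  have "?R \<longleftrightarrow> (\<exists>F. (\<forall>i < fst W. F i \<in> carrier (coordinate_algebra V)) \<and>
         (\<forall>P \<in> snd V. \<forall>i < fst W. f P i = coord_eval (F i) P))" (is "_ \<longleftrightarrow> ?S")
  proof
    assume ?R
    then obtain p where "\<forall>i < fst W. p i \<in> polys (fst V) \<and> (\<forall>P \<in> snd V. f P i = poly_eval (p i) P)" ..
    then show ?S
      by (intro exI[of _ "\<lambda>i. poly_class V (p i)"])
        (auto simp: coordinate_algebra_carrier coord_eval_class)
  next
    assume ?S
    then obtain F where F: "\<forall>i < fst W. \<exists>p \<in> polys (fst V). F i = poly_class V p"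
      "\<forall>P \<in> snd V. \<forall>i < fst W. f P i = coord_eval (F i) P"
      by (auto simp: coordinate_algebra_carrier image_iff)
    from F(1) obtain p where "\<forall>i < fst W. p i \<in> polys (fst V) \<and> F i = poly_class V (p i)"
      by metis
    with F(2) show ?R
      by (intro exI[of _ p]) (auto simp: coord_eval_class)
  qed
  then show ?thesis by (simp add: regular_maps_def)
qed

text \<open>Substituting the coordinate polynomials of \<open>f\<close> into \<open>p\<close> gives
  \<open>q\<close>; the induction on \<open>p\<close> constructs the result without a substitution
  operation. It serves both composition of regular maps and the map \<open>k[f]\<close>.\<close>

lemma regular_pullback:
  assumes f: "f \<in> regular_maps V W" and p: "p \<in> polys (fst W)"
  obtains q where "q \<in> polys (fst V)" "\<And>P. P \<in> snd V \<Longrightarrow> poly_eval q P = poly_eval p (f P)"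
proof -
  have "\<exists>q \<in> polys (fst V). \<forall>P \<in> snd V. poly_eval q P = poly_eval p (f P)"
    using p
  proof (induction rule: polys_induct)
    case (const c)
    show ?case by (rule bexI[of _ "mpoly_const c"]) auto
  next
    case (var i)
    with f show ?case by (auto simp: regular_maps_iff)
  next
    case (add p q)
    then obtain p' q' where "p' \<in> polys (fst V)" "\<forall>P \<in> snd V. poly_eval p' P = poly_eval p (f P)"
      "q' \<in> polys (fst V)" "\<forall>P \<in> snd V. poly_eval q' P = poly_eval q (f P)" by blast
    then show ?case by (intro bexI[of _ "p' + q'"]) auto
  next
    case (mult p q)
    then obtain p' q' where "p' \<in> polys (fst V)" "\<forall>P \<in> snd V. poly_eval p' P = poly_eval p (f P)"
      "q' \<in> polys (fst V)" "\<forall>P \<in> snd V. poly_eval q' P = poly_eval q (f P)" by blast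
    then show ?case by (intro bexI[of _ "p' * q'"]) auto
  qed
  then show ?thesis using that by blast
qed

lemma regular_maps_funcset: "f \<in> regular_maps V W \<Longrightarrow> f \<in> snd V \<rightarrow>\<^sub>E snd W"
  by (simp add: regular_maps_iff)

lemma regular_maps_id: "(\<lambda>P\<in>snd V. P) \<in> regular_maps V V"
  unfolding regular_maps_iff by (auto intro!: exI[of _ mpoly_var])

lemma regular_maps_compose:
  assumes f: "f \<in> regular_maps U V" and g: "g \<in> regular_maps V W"
  shows "compose (snd U) g f \<in> regular_maps U W"
proof -
  note ext = regular_maps_funcset[OF f] regular_maps_funcset[OF g]
  from g obtain p where p: "\<forall>i < fst W. p i \<in> polys (fst V) \<and> (\<forall>P \<in> snd V. g P i = poly_eval (p i) P)"
    by (auto simp: regular_maps_iff)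
  have "\<exists>q. i < fst W \<longrightarrow> q \<in> polys (fst U) \<and> (\<forall>P \<in> snd U. poly_eval q P = poly_eval (p i) (f P))" for i
    using regular_pullback[OF f, of "p i"] p by metis
  then obtain q where "\<And>i. i < fst W \<Longrightarrow>
      q i \<in> polys (fst U) \<and> (\<forall>P \<in> snd U. poly_eval (q i) P = poly_eval (p i) (f P))" by metis
  moreover have "f P \<in> snd V" "g (f P) \<in> snd W" if "P \<in> snd U" for P
    using that ext by auto
  ultimately show ?thesis
    using p unfolding regular_maps_iff by (auto simp: compose_def intro!: exI[of _ q])
qed

lemma affine_varieties_simps [simp]:
  "V \<in> Obj affine_varieties \<longleftrightarrow> algebraic_subset (fst V) (snd V)"
  "Hom affine_varieties = regular_maps"
  "cat.Id affine_varieties V = (\<lambda>P\<in>snd V. P)"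
  "Comp affine_varieties U V W g f = compose (snd U) g f"
  by (auto simp: affine_varieties_def)

lemma category_affine_varieties:
  "category (affine_varieties :: ('k::field variety, (nat \<Rightarrow> 'k) \<Rightarrow> (nat \<Rightarrow> 'k)) cat)"
proof
  fix U V W Z :: "'k::field variety" and f g h
  assume "f \<in> Hom affine_varieties U V" "g \<in> Hom affine_varieties V W" "h \<in> Hom affine_varieties W Z"
  then show "Comp affine_varieties U V Z (Comp affine_varieties V W Z h g) f
     = Comp affine_varieties U W Z h (Comp affine_varieties U V W g f)"
    using regular_maps_funcset[of f U V]
    by (auto simp: compose_def fun_eq_iff restrict_def)
next
  fix U V :: "'k::field variety" and f
  assume "f \<in> Hom affine_varieties U V"
  then have "f \<in> snd U \<rightarrow>\<^sub>E snd V" by (simp add: regular_maps_funcset)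
  then show "Comp affine_varieties U U V f (cat.Id affine_varieties U) = f"
    "Comp affine_varieties U V V (cat.Id affine_varieties V) f = f"
    by (auto simp: compose_def fun_eq_iff PiE_def extensional_def Pi_def)
qed (auto simp: regular_maps_id intro: regular_maps_compose)

section \<open>The category of essential algebras\<close>

lemma alg_homD:
  assumes "h \<in> alg_hom A B"
  shows "h \<in> carrier A \<rightarrow>\<^sub>E carrier B"
    and "x \<in> carrier A \<Longrightarrow> h x \<in> carrier B"
    and "\<lbrakk>x \<in> carrier A; y \<in> carrier A\<rbrakk> \<Longrightarrow> h (x \<otimes>\<^bsub>A\<^esub> y) = h x \<otimes>\<^bsub>B\<^esub> h y"
    and "\<lbrakk>x \<in> carrier A; y \<in> carrier A\<rbrakk> \<Longrightarrow> h (x \<oplus>\<^bsub>A\<^esub> y) = h x \<oplus>\<^bsub>B\<^esub> h y"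
    and "h \<one>\<^bsub>A\<^esub> = \<one>\<^bsub>B\<^esub>"
    and "x \<in> carrier A \<Longrightarrow> h (c \<odot>\<^bsub>A\<^esub> x) = c \<odot>\<^bsub>B\<^esub> h x"
  using assms by (auto simp: alg_hom_def ring_hom_def)

lemma alg_homI:
  assumes "h \<in> carrier A \<rightarrow>\<^sub>E carrier B"
    and "\<And>x y. \<lbrakk>x \<in> carrier A; y \<in> carrier A\<rbrakk> \<Longrightarrow> h (x \<otimes>\<^bsub>A\<^esub> y) = h x \<otimes>\<^bsub>B\<^esub> h y"
    and "\<And>x y. \<lbrakk>x \<in> carrier A; y \<in> carrier A\<rbrakk> \<Longrightarrow> h (x \<oplus>\<^bsub>A\<^esub> y) = h x \<oplus>\<^bsub>B\<^esub> h y"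
    and "h \<one>\<^bsub>A\<^esub> = \<one>\<^bsub>B\<^esub>"
    and "\<And>c x. x \<in> carrier A \<Longrightarrow> h (c \<odot>\<^bsub>A\<^esub> x) = c \<odot>\<^bsub>B\<^esub> h x"
  shows "h \<in> alg_hom A B"
  using assms by (auto simp: alg_hom_def ring_hom_def)

lemma k_algebraD:
  fixes A :: "('k::field, 'u) module"
  assumes "k_algebra A"
  shows "cring A"
    and "\<And>c x. x \<in> carrier A \<Longrightarrow> c \<odot>\<^bsub>A\<^esub> x \<in> carrier A"
    and "\<one>\<^bsub>A\<^esub> \<in> carrier A"
    and "\<And>x y. \<lbrakk>x \<in> carrier A; y \<in> carrier A\<rbrakk> \<Longrightarrow> x \<otimes>\<^bsub>A\<^esub> y \<in> carrier A"
    and "\<And>x y. \<lbrakk>x \<in> carrier A; y \<in> carrier A\<rbrakk> \<Longrightarrow> x \<oplus>\<^bsub>A\<^esub> y \<in> carrier A"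
proof -
  interpret algebra "ring_of_type_algebra :: 'k ring" A
    using assms by (simp add: k_algebra_def)
  show "cring A" by (rule M_cring)
  show "c \<odot>\<^bsub>A\<^esub> x \<in> carrier A" if "x \<in> carrier A" for c x
    using smult_closed[of c x] that by (simp add: ring_of_type_algebra_def)
qed (use assms in \<open>auto simp: k_algebra_def algebra_def intro: cring.cring_simprules\<close>)

lemma alg_hom_compose:
  assumes f: "f \<in> alg_hom A B" and g: "g \<in> alg_hom B E" and A: "k_algebra A"
  shows "compose (carrier A) g f \<in> alg_hom A E"
  by (rule alg_homI)
    (use alg_homD(2-)[OF f] alg_homD(2-)[OF g] k_algebraD[OF A] in \<open>simp_all add: compose_def\<close>)

lemma alg_hom_id: "k_algebra A \<Longrightarrow> (\<lambda>a\<in>carrier A. a) \<in> alg_hom A A"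
  by (rule alg_homI) (auto dest: k_algebraD)

lemma essential_algebras_simps [simp]:
  "A \<in> Obj essential_algebras \<longleftrightarrow> k_algebra A \<and> essential A \<and> finite_type A"
  "Hom essential_algebras = alg_hom"
  "cat.Id essential_algebras A = (\<lambda>a\<in>carrier A. a)"
  "Comp essential_algebras A B E h g = compose (carrier A) h g"
  by (auto simp: essential_algebras_def)

lemma category_essential_algebras:
  "category (essential_algebras :: (('k::field, 'u) module, 'u \<Rightarrow> 'u) cat)"
proof
  fix A B E Z :: "('k::field, 'u) module" and f g h
  assume "f \<in> Hom essential_algebras A B"
  then show "Comp essential_algebras A B Z (Comp essential_algebras B E Z h g) f
     = Comp essential_algebras A E Z h (Comp essential_algebras A B E g f)"
    using alg_homD(2)[of f A B]
    by (auto simp: compose_def fun_eq_iff restrict_def)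
next
  fix A B :: "('k::field, 'u) module" and f
  assume "f \<in> Hom essential_algebras A B"
  then have "f \<in> carrier A \<rightarrow>\<^sub>E carrier B" by (simp add: alg_homD)
  then show "Comp essential_algebras A A B f (cat.Id essential_algebras A) = f"
    "Comp essential_algebras A B B (cat.Id essential_algebras B) f = f"
    by (auto simp: compose_def fun_eq_iff PiE_def extensional_def Pi_def)
qed (auto simp: alg_hom_id intro: alg_hom_compose)

text \<open>The inverse \<open>g\<close> respects an operation because \<open>h\<close> sends the
  result computed from \<open>g x\<close> and \<open>g y\<close> to the one computed from
  \<open>x\<close> and \<open>y\<close>; applying \<open>g\<close> gives the law.\<close>

lemma bij_alg_hom_iso_arrow:
  assumes h: "h \<in> alg_hom A B" and bij: "bij_betw h (carrier A) (carrier B)"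
    and A: "k_algebra A"
  shows "iso_arrow essential_algebras A B h"
proof -
  define g where "g = (\<lambda>b\<in>carrier B. inv_into (carrier A) h b)"
  have gB: "g b \<in> carrier A" "h (g b) = b" if "b \<in> carrier B" for b
    using that bij by (auto simp: g_def bij_betw_def inv_into_into f_inv_into_f)
  have gh: "g (h a) = a" if "a \<in> carrier A" for a
    using that bij alg_homD(2)[OF h that] by (auto simp: g_def bij_betw_def)
  note closed = k_algebraD[OF A] and hom = alg_homD(2-)[OF h]
  have "g \<in> alg_hom B A"
  proof (rule alg_homI)
    show "g \<in> carrier B \<rightarrow>\<^sub>E carrier A" using gB by (auto simp: g_def)
    show "g (x \<otimes>\<^bsub>B\<^esub> y) = g x \<otimes>\<^bsub>A\<^esub> g y" if "x \<in> carrier B" "y \<in> carrier B" for x y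
      using gh[of "g x \<otimes>\<^bsub>A\<^esub> g y"] that by (simp add: gB closed hom)
    show "g (x \<oplus>\<^bsub>B\<^esub> y) = g x \<oplus>\<^bsub>A\<^esub> g y" if "x \<in> carrier B" "y \<in> carrier B" for x y
      using gh[of "g x \<oplus>\<^bsub>A\<^esub> g y"] that by (simp add: gB closed hom)
    show "g \<one>\<^bsub>B\<^esub> = \<one>\<^bsub>A\<^esub>"
      using gh[of "\<one>\<^bsub>A\<^esub>"] by (simp add: closed hom)
    show "g (c \<odot>\<^bsub>B\<^esub> x) = c \<odot>\<^bsub>A\<^esub> g x" if "x \<in> carrier B" for c x
      using gh[of "c \<odot>\<^bsub>A\<^esub> g x"] that by (simp add: gB closed hom)
  qed
  with h show ?thesis
    unfolding iso_arrow_def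
    by (auto intro!: bexI[of _ g] simp: compose_def gh gB cong: restrict_cong)
qed

section \<open>The coordinate algebra functor\<close>

text \<open>Treats both halves of the theorem at once: the identity as \<open>\<iota>\<close> gives
  the coordinate algebras themselves, an arbitrary injection the transported ones.\<close>

locale carrier_embedding =
  fixes \<iota> :: "'k::field mpoly set \<Rightarrow> 'u"
  assumes inj: "inj \<iota>"
begin

abbreviation coord_alg :: "'k variety \<Rightarrow> ('k, 'u) module" where
  "coord_alg V \<equiv> transport_algebra \<iota> (coordinate_algebra V)"

abbreviation coord_hom :: "'k variety \<Rightarrow> 'k variety
    \<Rightarrow> ((nat \<Rightarrow> 'k) \<Rightarrow> (nat \<Rightarrow> 'k)) \<Rightarrow> 'u \<Rightarrow> 'u" where
  "coord_hom V W f \<equiv> transport_hom \<iota> (coordinate_algebra W) (coordinate_map V W f)"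

text \<open>Elements of the transported algebra are built from polynomials with \<open>cls\<close>
  and compared through their values with \<open>val\<close>, so \<open>\<iota>\<close> rarely has to
  be mentioned.\<close>

definition cls :: "'k variety \<Rightarrow> 'k mpoly \<Rightarrow> 'u" where
  "cls V p = \<iota> (poly_class V p)"

definition val :: "'u \<Rightarrow> (nat \<Rightarrow> 'k) \<Rightarrow> 'k" where
  "val a P = coord_eval (inv_into UNIV \<iota> a) P"

lemma coord_alg_carrier: "carrier (coord_alg V) = cls V ` polys (fst V)"
  by (simp add: transport_algebra_def coordinate_algebra_carrier image_image cls_def)

lemma coord_alg_cases:
  assumes "a \<in> carrier (coord_alg V)"
  obtains p where "p \<in> polys (fst V)" "a = cls V p"
  using assms by (auto simp: coord_alg_carrier)

lemma cls_simps [simp]: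
  "p \<in> polys (fst V) \<Longrightarrow> cls V p \<in> carrier (coord_alg V)"
  "\<one>\<^bsub>coord_alg V\<^esub> = cls V 1"
  "\<zero>\<^bsub>coord_alg V\<^esub> = cls V 0"
  "\<lbrakk>p \<in> polys (fst V); q \<in> polys (fst V)\<rbrakk> \<Longrightarrow> cls V p \<otimes>\<^bsub>coord_alg V\<^esub> cls V q = cls V (p * q)"
  "\<lbrakk>p \<in> polys (fst V); q \<in> polys (fst V)\<rbrakk> \<Longrightarrow> cls V p \<oplus>\<^bsub>coord_alg V\<^esub> cls V q = cls V (p + q)"
  "p \<in> polys (fst V) \<Longrightarrow> c \<odot>\<^bsub>coord_alg V\<^esub> cls V p = cls V (mpoly_const c * p)"
  using inj by (auto simp: coord_alg_carrier)
    (simp_all add: transport_algebra_def cls_def coordinate_algebra_one coordinate_algebra_zero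
      coordinate_algebra_add coordinate_algebra_mult coordinate_algebra_smult)

lemma cls_eq_iff:
  "\<lbrakk>p \<in> polys (fst V); q \<in> polys (fst V)\<rbrakk> \<Longrightarrow>
    cls V p = cls V q \<longleftrightarrow> (\<forall>P\<in>snd V. poly_eval p P = poly_eval q P)"
  using inj by (simp add: cls_def inj_eq poly_class_eq_iff)

lemma val_cls [simp]: "\<lbrakk>p \<in> polys (fst V); P \<in> snd V\<rbrakk> \<Longrightarrow> val (cls V p) P = poly_eval p P"
  using inj by (simp add: val_def cls_def coord_eval_class)

lemma cls_alg_hom: "(\<lambda>p\<in>polys (fst V). cls V p) \<in> alg_hom (poly_algebra (fst V)) (coord_alg V)"
  by (rule alg_homI) auto

lemma coord_alg_eqI:
  assumes "a \<in> carrier (coord_alg V)" "b \<in> carrier (coord_alg V)"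
    "\<And>P. P \<in> snd V \<Longrightarrow> val a P = val b P"
  shows "a = b"
  using assms by (auto elim!: coord_alg_cases simp: cls_eq_iff)

lemma coord_alg_k_algebra: "k_algebra (coord_alg V)"
  by (rule k_algebraI[where S = "snd V" and ev = val and j = id])
    (auto elim!: coord_alg_cases simp: cls_eq_iff)

text \<open>The exponent set is \<open>V\<close> itself: an element goes to its function on
  \<open>V\<close>, which determines it.\<close>

lemma coord_alg_essential: "essential (coord_alg V)"
proof (rule essentialI)
  let ?\<phi> = "\<lambda>a\<in>carrier (coord_alg V). \<lambda>P\<in>snd V. val a P"
  note closed = k_algebraD[OF coord_alg_k_algebra]
  show "?\<phi> \<in> alg_hom (coord_alg V) (power_algebra (snd V))"
    by (rule alg_homI)
      (auto simp: power_algebra_def closed elim!: coord_alg_cases intro!: restrict_ext)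
  show "inj_on ?\<phi> (carrier (coord_alg V))"
  proof (rule inj_onI)
    fix a b assume ab: "a \<in> carrier (coord_alg V)" "b \<in> carrier (coord_alg V)" "?\<phi> a = ?\<phi> b"
    then have "(\<lambda>P\<in>snd V. val a P) P = (\<lambda>P\<in>snd V. val b P) P" for P by simp
    with ab(1,2) show "a = b" by (metis coord_alg_eqI restrict_apply')
  qed
qed (rule coord_alg_k_algebra)

lemma coord_alg_finite_type: "finite_type (coord_alg V)"
  unfolding finite_type_def
  by (rule exI[of _ "fst V"], rule bexI[OF _ cls_alg_hom]) (simp add: coord_alg_carrier)

section \<open>The action of the functor on regular maps\<close>

text \<open>The class of \<open>q\<close> has the values demanded in the definite description of
  \<open>coordinate_map\<close>, and it is the only one, since values on \<open>V\<close> determine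
  a class.\<close>

lemma coord_hom_cls:
  assumes f: "f \<in> regular_maps V W" and p: "p \<in> polys (fst W)" and q: "q \<in> polys (fst V)"
    and eq: "\<And>P. P \<in> snd V \<Longrightarrow> poly_eval q P = poly_eval p (f P)"
  shows "coord_hom V W f (cls W p) = cls V q"
proof -
  have W: "f P \<in> snd W" if "P \<in> snd V" for P
    using regular_maps_funcset[OF f] that by auto
  have "(THE h. h \<in> carrier (coordinate_algebra V) \<and>
      (\<forall>P\<in>snd V. coord_eval h P = coord_eval (poly_class W p) (f P))) = poly_class V q"
  proof (rule the_equality)
    fix h assume h: "h \<in> carrier (coordinate_algebra V) \<and>
      (\<forall>P\<in>snd V. coord_eval h P = coord_eval (poly_class W p) (f P))"
    then obtain r where "r \<in> polys (fst V)" "h = poly_class V r"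
      by (auto simp: coordinate_algebra_carrier)
    with h p q eq W show "h = poly_class V q"
      by (simp add: coord_eval_class poly_class_eq_iff)
  qed (use p q eq W in \<open>simp_all add: coordinate_algebra_carrier coord_eval_class\<close>)
  with p have "coordinate_map V W f (poly_class W p) = poly_class V q"
    by (simp add: coordinate_map_def coordinate_algebra_carrier)
  with p inj show ?thesis
    by (simp add: transport_hom_def coordinate_algebra_carrier cls_def)
qed

text \<open>With extensionality, these two facts determine \<open>coord_hom V W f\<close>; the
  functor laws and full faithfulness are derived from them.\<close>

lemma coord_hom_props:
  assumes f: "f \<in> regular_maps V W" and a: "a \<in> carrier (coord_alg W)"
  shows "coord_hom V W f a \<in> carrier (coord_alg V)"
    and "P \<in> snd V \<Longrightarrow> val (coord_hom V W f a) P = val a (f P)"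
proof -
  obtain p where p: "p \<in> polys (fst W)" "a = cls W p" using a by (rule coord_alg_cases)
  obtain q where q: "q \<in> polys (fst V)" "\<And>P. P \<in> snd V \<Longrightarrow> poly_eval q P = poly_eval p (f P)"
    using regular_pullback[OF f p(1)] by blast
  have "coord_hom V W f a = cls V q"
    using coord_hom_cls[OF f p(1) q] p(2) by simp
  moreover have "f P \<in> snd W" if "P \<in> snd V" for P
    using regular_maps_funcset[OF f] that by auto
  ultimately show "coord_hom V W f a \<in> carrier (coord_alg V)"
    "P \<in> snd V \<Longrightarrow> val (coord_hom V W f a) P = val a (f P)"
    using p q by auto
qed

lemma coord_hom_extensional: "coord_hom V W f \<in> extensional (carrier (coord_alg W))"
  by (simp add: transport_hom_def transport_algebra_def)

lemma val_hom:
  assumes "a \<in> carrier (coord_alg V)" "P \<in> snd V"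
  shows "b \<in> carrier (coord_alg V) \<Longrightarrow> val (a \<otimes>\<^bsub>coord_alg V\<^esub> b) P = val a P * val b P"
    and "b \<in> carrier (coord_alg V) \<Longrightarrow> val (a \<oplus>\<^bsub>coord_alg V\<^esub> b) P = val a P + val b P"
    and "val (c \<odot>\<^bsub>coord_alg V\<^esub> a) P = c * val a P"
  using assms by (auto elim!: coord_alg_cases)

lemma coord_hom_alg_hom:
  assumes f: "f \<in> regular_maps V W"
  shows "coord_hom V W f \<in> alg_hom (coord_alg W) (coord_alg V)"
proof -
  have W: "f P \<in> snd W" if "P \<in> snd V" for P
    using regular_maps_funcset[OF f] that by auto
  note closed = k_algebraD[OF coord_alg_k_algebra]
  have val_one: "val \<one>\<^bsub>coord_alg U\<^esub> P = 1" if "P \<in> snd U" for U P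
    using that by simp
  show ?thesis
    by (rule alg_homI)
      (auto simp: PiE_def coord_hom_extensional coord_hom_props[OF f] closed W val_hom val_one
        simp del: cls_simps(2,3) intro!: coord_alg_eqI[where V = V])
qed

lemma coord_hom_id: "coord_hom V V (\<lambda>P\<in>snd V. P) = (\<lambda>a\<in>carrier (coord_alg V). a)"
proof (rule extensionalityI[OF coord_hom_extensional restrict_extensional])
  fix a assume "a \<in> carrier (coord_alg V)"
  then show "coord_hom V V (\<lambda>P\<in>snd V. P) a = (\<lambda>a\<in>carrier (coord_alg V). a) a"
    by (auto intro!: coord_alg_eqI[where V = V] simp: coord_hom_props[OF regular_maps_id])
qed

lemma coord_hom_compose:
  assumes f: "f \<in> regular_maps U V" and g: "g \<in> regular_maps V W"
  shows "coord_hom U W (compose (snd U) g f)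
    = compose (carrier (coord_alg W)) (coord_hom U V f) (coord_hom V W g)"
proof (rule extensionalityI[OF coord_hom_extensional compose_extensional])
  fix a assume "a \<in> carrier (coord_alg W)"
  moreover have "f P \<in> snd V" if "P \<in> snd U" for P
    using regular_maps_funcset[OF f] that by auto
  ultimately show "coord_hom U W (compose (snd U) g f) a
      = compose (carrier (coord_alg W)) (coord_hom U V f) (coord_hom V W g) a"
    by (auto intro!: coord_alg_eqI[where V = U]
      simp: compose_eq coord_hom_props[OF f] coord_hom_props[OF g] coord_hom_props[OF regular_maps_compose[OF f g]])
qed

lemma coord_hom_functor:
  "cat_functor (op_cat (affine_varieties :: ('k variety, (nat \<Rightarrow> 'k) \<Rightarrow> (nat \<Rightarrow> 'k)) cat))
     (essential_algebras :: (('k, 'u) module, 'u \<Rightarrow> 'u) cat) coord_alg (\<lambda>U Y. coord_hom Y U)"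
  by (intro cat_functor.intro cat_functor_axioms.intro category_op_cat
      category_affine_varieties category_essential_algebras)
    (auto simp: op_cat_def coord_alg_k_algebra coord_alg_essential coord_alg_finite_type
      coord_hom_alg_hom coord_hom_id coord_hom_compose)

section \<open>Full faithfulness\<close>

text \<open>Pulling back the class of the variable of index \<open>i\<close> recovers the coordinate
  \<open>f P i\<close>. Algebraicity of \<open>W\<close> places its points in affine space, where
  coordinates determine a point.\<close>

lemma coord_hom_faithful:
  assumes f: "f \<in> regular_maps V W" and g: "g \<in> regular_maps V W"
    and W: "algebraic_subset (fst W) (snd W)"
    and eq: "coord_hom V W f = coord_hom V W g"
  shows "f = g"
proof (rule PiE_ext)
  show fg: "f \<in> snd V \<rightarrow>\<^sub>E snd W" "g \<in> snd V \<rightarrow>\<^sub>E snd W"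
    using f g by (simp_all add: regular_maps_funcset)
  fix P assume P: "P \<in> snd V"
  have W_sub: "snd W \<subseteq> {..<fst W} \<rightarrow>\<^sub>E UNIV"
    using W by (auto simp: algebraic_subset_def zero_set_def affine_space_def)
  have fP: "f P \<in> snd W" "g P \<in> snd W" using fg P by auto
  show "f P = g P"
  proof (rule PiE_ext)
    show "f P \<in> {..<fst W} \<rightarrow>\<^sub>E UNIV" "g P \<in> {..<fst W} \<rightarrow>\<^sub>E UNIV" using fP W_sub by auto
    fix i assume "i \<in> {..<fst W}"
    then have i: "(mpoly_var i :: 'k mpoly) \<in> polys (fst W)" by simp
    show "f P i = g P i"
      using coord_hom_props(2)[OF f cls_simps(1)[OF i] P] coord_hom_props(2)[OF g cls_simps(1)[OF i] P]
        eq i fP by simp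
  qed
qed

lemma coord_hom_full:
  assumes W: "algebraic_subset (fst W) (snd W)"
    and h: "h \<in> alg_hom (coord_alg W) (coord_alg V)"
  shows "\<exists>f \<in> regular_maps V W. coord_hom V W f = h"
proof -
  note hD = alg_homD(2-)[OF h]
  define f where "f = (\<lambda>P\<in>snd V. \<lambda>i\<in>{..<fst W}. val (h (cls W (mpoly_var i))) P)"
  have eval: "val (h (cls W p)) P = poly_eval p (f P)" if "p \<in> polys (fst W)" "P \<in> snd V" for p P
    using that(1)
  proof (rule hom_eq_poly_eval)
    show "val (h (cls W 1)) P = 1" using hD(4) that(2) by simp
    show "val (h (cls W (mpoly_const c * p))) P = c * val (h (cls W p)) P"
      if "p \<in> polys (fst W)" for c p
      using hD(5)[of "cls W p" c] that \<open>P \<in> snd V\<close> by (simp add: hD(1) val_hom)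
    show "val (h (cls W (p + q))) P = val (h (cls W p)) P + val (h (cls W q)) P"
      if "p \<in> polys (fst W)" "q \<in> polys (fst W)" for p q
      using hD(3)[of "cls W p" "cls W q"] that \<open>P \<in> snd V\<close> by (simp add: hD(1) val_hom)
    show "val (h (cls W (p * q))) P = val (h (cls W p)) P * val (h (cls W q)) P"
      if "p \<in> polys (fst W)" "q \<in> polys (fst W)" for p q
      using hD(2)[of "cls W p" "cls W q"] that \<open>P \<in> snd V\<close> by (simp add: hD(1) val_hom)
    show "val (h (cls W (mpoly_var i))) P = f P i" if "i < fst W" for i
      using that \<open>P \<in> snd V\<close> by (simp add: f_def)
  qed
  \<comment> \<open>Preservation of zero is not among the clauses of \<open>alg_hom\<close>; it
    follows from linearity with the scalar 0.\<close>
  have h0: "h (cls W 0) = cls V 0"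
  proof -
    obtain p where "p \<in> polys (fst V)" "h (cls W 0) = cls V p"
      using hD(1)[of "cls W 0"] by (auto elim: coord_alg_cases)
    then show ?thesis
      using hD(5)[of "cls W 0" 0] by (simp add: mpoly_const_def)
  qed
  obtain I where I: "I \<subseteq> polys (fst W)" "snd W = zero_set (fst W) I"
  proof -
    from W obtain I where "ideal I (poly_algebra (fst W))" "snd W = zero_set (fst W) I"
      unfolding algebraic_subset_def by blast
    with that show thesis using ideal.Icarr[of I "poly_algebra (fst W)"] by auto
  qed
  have fW: "f P \<in> snd W" if "P \<in> snd V" for P
  proof -
    have "poly_eval p (f P) = 0" if "p \<in> I" for p
    proof -
      have p: "p \<in> polys (fst W)" using I that by blast
      \<comment> \<open>An equation of \<open>W\<close> vanishes on \<open>W\<close>, so its class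
        is zero and \<open>h\<close> kills it; by \<open>eval\<close> it then vanishes at
        \<open>f P\<close>.\<close>
      have "cls W p = cls W 0"
        using p that I by (subst cls_eq_iff) (auto simp: zero_set_def)
      with eval[OF p \<open>P \<in> snd V\<close>] h0 \<open>P \<in> snd V\<close> show ?thesis by simp
    qed
    with that show ?thesis
      by (simp add: I zero_set_def affine_space_def f_def)
  qed
  \<comment> \<open>Representatives of the images of the variables are the polynomials that make
    \<open>f\<close> regular.\<close>
  have "\<exists>q \<in> polys (fst V). h (cls W (mpoly_var i)) = cls V q" if "i < fst W" for i
    using hD(1)[of "cls W (mpoly_var i)"] that by (auto elim: coord_alg_cases)
  then obtain q where q: "\<And>i. i < fst W \<Longrightarrow> q i \<in> polys (fst V) \<and> h (cls W (mpoly_var i)) = cls V (q i)"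
    by metis
  have f: "f \<in> regular_maps V W"
    unfolding regular_maps_iff
  proof
    show "f \<in> snd V \<rightarrow>\<^sub>E snd W" using fW by (auto simp: f_def)
  qed (use q in \<open>auto intro!: exI[of _ q] simp: f_def\<close>)
  have "coord_hom V W f = h"
  proof (rule extensionalityI[OF coord_hom_extensional])
    show "h \<in> extensional (carrier (coord_alg W))"
      using alg_homD(1)[OF h] by (simp add: PiE_def)
    fix a assume a: "a \<in> carrier (coord_alg W)"
    show "coord_hom V W f a = h a"
    proof (rule coord_alg_eqI)
      fix P assume "P \<in> snd V"
      with a fW show "val (coord_hom V W f a) P = val (h a) P"
        by (auto simp: coord_hom_props[OF f] eval elim!: coord_alg_cases)
    qed (use a in \<open>auto simp: coord_hom_props[OF f] hD\<close>)
  qed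
  with f show ?thesis by blast
qed

section \<open>Essential surjectivity\<close>

lemma coord_alg_surj:
  fixes A :: "('k, 'u) module"
  assumes A: "k_algebra A" and ess: "essential A" and ft: "finite_type A"
  shows "\<exists>V. algebraic_subset (fst V) (snd V) \<and> (\<exists>e. iso_arrow essential_algebras (coord_alg V) A e)"
proof -
  obtain n \<pi> where \<pi>: "\<pi> \<in> alg_hom (poly_algebra n) A" and surj: "\<pi> ` polys n = carrier A"
    using ft by (auto simp: finite_type_def)
  obtain S :: "('u \<Rightarrow> 'k) set" and \<phi> where \<phi>: "\<phi> \<in> alg_hom A (power_algebra S)"
    and inj\<phi>: "inj_on \<phi> (carrier A)"
    using ess by (auto simp: essential_def)
  note \<pi>D = alg_homD(2-)[OF \<pi>, simplified] and \<phi>D = alg_homD(2-)[OF \<phi>]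
  interpret A: cring A using A by (rule k_algebraD)
  interpret R: cring "poly_algebra n :: ('k, 'k mpoly) module"
    by (rule k_algebraD[OF k_algebra_poly_algebra])
  interpret \<pi>: ring_hom_ring "poly_algebra n" A \<pi>
    using \<pi> by (intro ring_hom_ringI2) (auto simp: alg_hom_def intro: A.ring_axioms R.ring_axioms)
  define I where "I = a_kernel (poly_algebra n) A \<pi>"
  define V where "V = (n, zero_set n I)"
  have fst: "fst V = n" by (simp add: V_def)
  have alg: "algebraic_subset (fst V) (snd V)"
    unfolding algebraic_subset_def
  proof (intro exI conjI)
    show "ideal I (poly_algebra (fst V))"
      unfolding fst I_def by (rule \<pi>.kernel_is_ideal)
    show "snd V = zero_set (fst V) I"
      unfolding V_def snd_conv fst_conv by (rule refl)
  qed
  have I_iff: "p \<in> I \<longleftrightarrow> p \<in> polys n \<and> \<pi> p = \<zero>\<^bsub>A\<^esub>" for p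
    unfolding I_def a_kernel_def' by simp
  \<comment> \<open>Each \<open>s\<close> gives a homomorphism from \<open>A\<close> to the field,
    namely \<open>a \<mapsto> \<phi> a s\<close>. Its values on the generators
    \<open>\<pi> (mpoly_var i)\<close> are the coordinates of a point, restricted to indices below
    \<open>n\<close> as affine space requires.\<close>
  define pt where "pt s = (\<lambda>i\<in>{..<n}. \<phi> (\<pi> (mpoly_var i)) s)" for s
  have pt: "\<phi> (\<pi> p) s = poly_eval p (pt s)" if "p \<in> polys n" "s \<in> S" for p s
    using that(1)
  proof (rule hom_eq_poly_eval)
    show "\<phi> (\<pi> (mpoly_const c * p)) s = c * \<phi> (\<pi> p) s" if "p \<in> polys n" for c p
      unfolding \<pi>D(5)[OF that] using \<phi>D(5)[of "\<pi> p" c] \<pi>D(1)[OF that] \<open>s \<in> S\<close>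
      by (simp add: power_algebra_def)
  qed (use that(2) in \<open>auto simp: \<pi>D \<phi>D power_algebra_def pt_def\<close>)
  have \<phi>0: "\<phi> \<zero>\<^bsub>A\<^esub> s = 0" if "s \<in> S" for s
    using pt[of 0 s] that \<pi>.hom_zero by simp
  have pt_V: "pt s \<in> snd V" if "s \<in> S" for s
  proof -
    have "poly_eval p (pt s) = 0" if "p \<in> I" for p
      using that pt[of p s] \<phi>0[of s] \<open>s \<in> S\<close> by (simp add: I_iff)
    then show ?thesis by (simp add: V_def zero_set_def affine_space_def pt_def)
  qed
  \<comment> \<open>The kernel of \<open>\<pi>\<close> is the whole vanishing ideal of
    \<open>V\<close>. One inclusion is the definition of \<open>V\<close>; for the other, the points
    \<open>pt s\<close> lie on \<open>V\<close> and \<open>\<phi>\<close> is injective, which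
    replaces the Nullstellensatz.\<close>
  have key: "\<pi> p = \<pi> q \<longleftrightarrow> cls V p = cls V q" if p: "p \<in> polys n" and q: "q \<in> polys n" for p q
  proof -
    have "\<pi> p = \<pi> q \<longleftrightarrow> (\<forall>P\<in>snd V. poly_eval p P = poly_eval q P)"
    proof
      assume eq: "\<pi> p = \<pi> q"
      \<comment> \<open>The facts on \<open>\<pi>\<close> cover sums only, so \<open>p\<close> is
        written as \<open>(p - q) + q\<close> and \<open>\<pi> q\<close> is cancelled.\<close>
      have "\<pi> (p - q) \<oplus>\<^bsub>A\<^esub> \<pi> q = \<pi> q"
        using \<pi>D(3)[of "p - q" q] p q eq by simp
      then have "p - q \<in> I"
        using p q \<pi>D(1) by (simp add: I_iff)
      then have "poly_eval (p - q) P = 0" if "P \<in> snd V" for P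
        using that unfolding V_def zero_set_def snd_conv by blast
      then show "\<forall>P\<in>snd V. poly_eval p P = poly_eval q P" by simp
    next
      assume eq: "\<forall>P\<in>snd V. poly_eval p P = poly_eval q P"
      have "\<phi> (\<pi> p) = \<phi> (\<pi> q)"
      proof (rule PiE_ext)
        show "\<phi> (\<pi> p) \<in> S \<rightarrow>\<^sub>E UNIV" "\<phi> (\<pi> q) \<in> S \<rightarrow>\<^sub>E UNIV"
          using \<phi>D(1)[OF \<pi>D(1)[OF p]] \<phi>D(1)[OF \<pi>D(1)[OF q]] by (simp_all add: power_algebra_def)
        show "\<phi> (\<pi> p) s = \<phi> (\<pi> q) s" if "s \<in> S" for s
          using eq pt_V[OF that] pt that p q by simp
      qed
      with inj\<phi> \<pi>D(1) p q show "\<pi> p = \<pi> q" by (simp add: inj_on_eq_iff)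
    qed
    with p q show ?thesis by (simp add: cls_eq_iff fst)
  qed
  \<comment> \<open>The isomorphism induced by \<open>\<pi>\<close> on classes, defined by an
    arbitrary representative; \<open>key\<close> makes the choice immaterial and also gives
    injectivity.\<close>
  define e where "e = (\<lambda>a\<in>carrier (coord_alg V). \<pi> (SOME p. p \<in> polys n \<and> cls V p = a))"
  have cls_n: "cls V p \<in> carrier (coord_alg V)" if "p \<in> polys n" for p
    using that fst by simp
  have e: "e (cls V p) = \<pi> p" if "p \<in> polys n" for p
  proof -
    let ?q = "SOME q. q \<in> polys n \<and> cls V q = cls V p"
    have "?q \<in> polys n \<and> cls V ?q = cls V p"
      using someI[of "\<lambda>q. q \<in> polys n \<and> cls V q = cls V p" p] that by blast
    then have "\<pi> ?q = \<pi> p" using key[of ?q p] that by blast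
    then show ?thesis unfolding e_def restrict_apply'[OF cls_n[OF that]] .
  qed
  have cases: thesis if "a \<in> carrier (coord_alg V)" "\<And>p. p \<in> polys n \<Longrightarrow> a = cls V p \<Longrightarrow> thesis" for a thesis
    using coord_alg_cases[OF that(1)] that(2) unfolding fst by blast
  have "e \<in> alg_hom (coord_alg V) A"
  proof (rule alg_homI)
    show "e \<in> carrier (coord_alg V) \<rightarrow>\<^sub>E carrier A"
    proof (rule PiE_I)
      show "e a \<in> carrier A" if "a \<in> carrier (coord_alg V)" for a
        using that by (rule cases) (simp add: e \<pi>D)
    qed (simp add: e_def)
  next
    fix a b assume "a \<in> carrier (coord_alg V)" "b \<in> carrier (coord_alg V)"
    then obtain p q where "p \<in> polys n" "q \<in> polys n" "a = cls V p" "b = cls V q"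
      by (meson cases)
    then show "e (a \<otimes>\<^bsub>coord_alg V\<^esub> b) = e a \<otimes>\<^bsub>A\<^esub> e b"
      "e (a \<oplus>\<^bsub>coord_alg V\<^esub> b) = e a \<oplus>\<^bsub>A\<^esub> e b"
      by (simp_all add: fst e \<pi>D)
  next
    show "e (c \<odot>\<^bsub>coord_alg V\<^esub> a) = c \<odot>\<^bsub>A\<^esub> e a" if "a \<in> carrier (coord_alg V)" for c a
      using that by (rule cases) (simp only: cls_simps fst e \<pi>D(5) polys_mult polys_const)
  qed (simp add: e \<pi>D)
  moreover have "bij_betw e (carrier (coord_alg V)) (carrier A)"
    unfolding bij_betw_def
  proof
    show "inj_on e (carrier (coord_alg V))"
      by (rule inj_onI) (auto elim!: cases simp: e key cls_n)
    show "e ` carrier (coord_alg V) = carrier A"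
      unfolding surj[symmetric] coord_alg_carrier fst by (auto simp: e image_image)
  qed
  ultimately show ?thesis
    using alg bij_alg_hom_iso_arrow coord_alg_k_algebra by blast
qed

lemma coord_alg_duality:
  "duality (affine_varieties :: ('k variety, (nat \<Rightarrow> 'k) \<Rightarrow> (nat \<Rightarrow> 'k)) cat)
     (essential_algebras :: (('k, 'u) module, 'u \<Rightarrow> 'u) cat) coord_alg coord_hom"
  unfolding duality_def
proof (rule cat_equivalenceI[OF coord_hom_functor])
  fix A :: "('k, 'u) module" assume "A \<in> Obj essential_algebras"
  then show "\<exists>V \<in> Obj (op_cat affine_varieties). \<exists>e. iso_arrow essential_algebras (coord_alg V) A e"
    using coord_alg_surj[of A] by (auto simp: op_cat_def)
qed (auto simp: op_cat_def intro: coord_hom_faithful coord_hom_full)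

end

theorem proposition2p22:
  shows "duality (affine_varieties :: ('k::field variety, (nat \<Rightarrow> 'k) \<Rightarrow> (nat \<Rightarrow> 'k)) cat)
           (essential_algebras :: (('k, 'k mpoly set) module, 'k mpoly set \<Rightarrow> 'k mpoly set) cat)
           coordinate_algebra coordinate_map
       \<and> (\<forall>\<iota> :: 'k mpoly set \<Rightarrow> 'u. inj \<iota> \<longrightarrow>
           duality (affine_varieties :: ('k variety, (nat \<Rightarrow> 'k) \<Rightarrow> (nat \<Rightarrow> 'k)) cat)
             (essential_algebras :: (('k, 'u) module, 'u \<Rightarrow> 'u) cat)
             (\<lambda>V. transport_algebra \<iota> (coordinate_algebra V))
             (\<lambda>V W f. transport_hom \<iota> (coordinate_algebra W) (coordinate_map V W f)))"
proof (intro conjI allI impI)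
  \<comment> \<open>For the first conjunct \<open>\<iota>\<close> is the identity, and transport
    along it changes neither the algebras nor the homomorphisms.\<close>
  interpret carrier_embedding "\<lambda>a :: 'k mpoly set. a"
    by unfold_locales simp
  have inv: "inv_into UNIV (\<lambda>a. a) a = a" for a :: "'k mpoly set"
    by (rule inv_f_f) simp
  have "transport_algebra (\<lambda>a. a) (coordinate_algebra V) = coordinate_algebra V" for V :: "'k variety"
    by (simp add: transport_algebra_def inv)
  moreover have "transport_hom (\<lambda>a. a) (coordinate_algebra W) (coordinate_map V W f) = coordinate_map V W f"
    for V W :: "'k variety" and f
    by (simp add: transport_hom_def coordinate_map_def inv cong: restrict_cong)
  ultimately show "duality (affine_varieties :: ('k variety, (nat \<Rightarrow> 'k) \<Rightarrow> (nat \<Rightarrow> 'k)) cat)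
      (essential_algebras :: (('k, 'k mpoly set) module, 'k mpoly set \<Rightarrow> 'k mpoly set) cat)
      coordinate_algebra coordinate_map"
    using coord_alg_duality by simp
qed (rule carrier_embedding.coord_alg_duality[OF carrier_embedding.intro])

end
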